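(* Let $\alpha\ge 2$, $h<0$ and $0<\epsilon<|h|^{-1/\alpha}$. For $\delta\in\{0,\epsilon\}$ consider the reduced flow of the problem with smoothed amended potential on the invariant set $\Sigma_{h,\delta}^{+}:=\{(r,v,u)\in\Sigma_{h,\delta}: r>0\}$ (for $\delta=0$ this is the non-smoothed flow). Then, for both $\delta=0$ and $\delta=\epsilon$, every orbit in $\Sigma_{h,\delta}^{+}$ is non-periodic and leads to/ejects from the collision manifold $M_\delta$, i.e. $r\to 0$ along it as $\tau\to\pm\infty$. Moreover, the non-smoothed flow on $\Sigma_{h,0}^{+}$ and the smoothed flow on $\Sigma_{h,\epsilon}^{+}$ are topologically equivalent.
   Context: For $\delta\ge 0$ consider the planar central-field Hamiltonian with smoothed amended potential $$H_\delta(r,\theta,p_r,p_\theta)=\frac12\Big(p_r^2+\frac{p_\theta^2}{r^2+\delta^2}\Big)-\frac{1}{(r^2+\delta^2)^{\alpha/2}};$$ for $\delta=0$ it is the Hamiltonian of a unit-mass particle in the homogeneous potential $-1/r^\alpha$. With $u=p_\theta(r^2+\delta^2)^{(\alpha-2)/4}$, $v=p_r(r^2+\delta^2)^{\alpha/4}$, $d\tau=r^{-(\alpha+2)/2}dt$, and after factoring out $\theta$, the reduced equations on $(r,v,u)\in[0,\infty)\times\mathbb{R}\times\mathbb{R}$ are $$r'=v\,r^{\frac{\alpha+2}{2}}(r^2+\delta^2)^{-\frac{\alpha}{4}},\quad v'=r^{\frac{\alpha+4}{2}}(r^2+\delta^2)^{-\frac{\alpha+4}{4}}\Big(u^2+\frac{\alpha}{2}v^2-\alpha\Big),\quad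 u'=\frac{\alpha-2}{2}\,r^{\frac{\alpha+4}{2}}(r^2+\delta^2)^{-\frac{\alpha+4}{4}}\,uv,$$ where $'=d/d\tau$ (for $\delta=0$ these read $r'=rv$, $v'=u^2+\frac{\alpha}{2}v^2-\alpha$, $u'=\frac{\alpha-2}{2}uv$, also at $r=0$). The reduced energy surface for energy $h<0$ is the invariant set $$\Sigma_{h,\delta}=\{(r,v,u)\in[0,\infty)\times\mathbb{R}^2: u^2+v^2=2\big(1-|h|(r^2+\delta^2)^{\alpha/2}\big)\},$$ and the collision manifold is $M_\delta=\Sigma_{h,\delta}\cap\{r=0\}$. Two flows are topologically equivalent if there is a homeomorphism between their phase spaces mapping orbits onto orbits and preserving the direction of time. *)

theory Defs
  imports "HOL-Analysis.Analysis"
begin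

section \<open>Flows of vector fields\<close>

text \<open>Integral curves of \<open>F\<close> inside \<open>P\<close>, on an open time interval containing 0.\<close>

definition integral_curve ::
    "('a::real_normed_vector \<Rightarrow> 'a) \<Rightarrow> 'a set \<Rightarrow> real set \<Rightarrow> (real \<Rightarrow> 'a) \<Rightarrow> bool" where
  "integral_curve F P I \<phi> \<longleftrightarrow>
     open I \<and> is_interval I \<and> 0 \<in> I \<and>
     (\<forall>t\<in>I. \<phi> t \<in> P \<and> (\<phi> has_vector_derivative F (\<phi> t)) (at t))"

text \<open>The point reached at time \<open>t\<close> from \<open>x\<close>; meaningful only where integral curves exist and
  are unique, which \<open>generates_flow_on\<close> below asserts.\<close>

definition flow_of ::
    "('a::real_normed_vector \<Rightarrow> 'a) \<Rightarrow> 'a set \<Rightarrow> real \<Rightarrow> 'a \<Rightarrow> 'a" where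
  "flow_of F P t x = (THE y. \<exists>I \<phi>. integral_curve F P I \<phi> \<and> \<phi> 0 = x \<and> t \<in> I \<and> \<phi> t = y)"

definition flow_on :: "'a::topological_space set \<Rightarrow> (real \<Rightarrow> 'a \<Rightarrow> 'a) \<Rightarrow> bool" where
  "flow_on S \<Phi> \<longleftrightarrow>
     (\<forall>t. \<forall>x\<in>S. \<Phi> t x \<in> S) \<and>
     (\<forall>x\<in>S. \<Phi> 0 x = x) \<and>
     (\<forall>s t. \<forall>x\<in>S. \<Phi> (s + t) x = \<Phi> s (\<Phi> t x)) \<and>
     continuous_on (UNIV \<times> S) (\<lambda>(t, x). \<Phi> t x)"

text \<open>\<open>F\<close>, a vector field on the phase space \<open>P\<close>, has a well-defined complete flow on the invariant
  set \<open>S\<close>. In the last conjunct the competing curves may move anywhere in \<open>P\<close>, so it contains the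
  invariance of \<open>S\<close> in \<open>P\<close> as well as uniqueness.\<close>

definition generates_flow_on ::
    "('a::real_normed_vector \<Rightarrow> 'a) \<Rightarrow> 'a set \<Rightarrow> 'a set \<Rightarrow> bool" where
  "generates_flow_on F P S \<longleftrightarrow>
     S \<subseteq> P \<and>
     flow_on S (flow_of F P) \<and>
     (\<forall>x\<in>S. integral_curve F P UNIV (\<lambda>t. flow_of F P t x)) \<and>
     (\<forall>I \<phi>. integral_curve F P I \<phi> \<and> \<phi> 0 \<in> S \<longrightarrow> (\<forall>t\<in>I. \<phi> t = flow_of F P t (\<phi> 0)))"

definition orbit :: "(real \<Rightarrow> 'a \<Rightarrow> 'a) \<Rightarrow> 'a \<Rightarrow> 'a set" where
  "orbit \<Phi> x = range (\<lambda>t. \<Phi> t x)"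

text \<open>Equilibria count as periodic here.\<close>

definition periodic :: "(real \<Rightarrow> 'a) \<Rightarrow> bool" where
  "periodic \<phi> \<longleftrightarrow> (\<exists>T>0. \<forall>t. \<phi> (t + T) = \<phi> t)"

text \<open>The direction of time is preserved: along every orbit, \<open>H\<close> intertwines the flows up to an
  increasing homeomorphism \<open>\<sigma>\<close> of the time axis.\<close>

definition topologically_equivalent ::
    "'a::topological_space set \<Rightarrow> (real \<Rightarrow> 'a \<Rightarrow> 'a) \<Rightarrow>
     'b::topological_space set \<Rightarrow> (real \<Rightarrow> 'b \<Rightarrow> 'b) \<Rightarrow> bool" where
  "topologically_equivalent S \<Phi> T \<Psi> \<longleftrightarrow>
     (\<exists>H K. homeomorphism S T H K \<and>
        (\<forall>x\<in>S. H ` orbit \<Phi> x = orbit \<Psi> (H x) \<and>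
           (\<exists>\<sigma>::real \<Rightarrow> real. strict_mono \<sigma> \<and> surj \<sigma> \<and>
              (\<forall>t. H (\<Phi> t x) = \<Psi> (\<sigma> t) (H x)))))"


section \<open>The reduced problem with smoothed amended potential\<close>

text \<open>A state is a triple \<open>(r, v, u)\<close>.\<close>

type_synonym state = "real \<times> real \<times> real"

definition phase_space :: "state set" where
  "phase_space = {(r, v, u). r \<ge> 0}"

text \<open>For \<open>\<delta> = 0\<close> the general formula is used in its simplified form, which extends to \<open>r = 0\<close>
  (where the factors \<open>0 powr _\<close> of the general formula would give 0); see
  \<open>reduced_field_eq\<close>.\<close>

definition reduced_field :: "real \<Rightarrow> real \<Rightarrow> state \<Rightarrow> state" where
  "reduced_field \<alpha> \<delta> = (\<lambda>(r, v, u).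
     if \<delta> = 0
     then (r * v,
           u\<^sup>2 + \<alpha> / 2 * v\<^sup>2 - \<alpha>,
           (\<alpha> - 2) / 2 * u * v)
     else (v * r powr ((\<alpha> + 2) / 2) * (r\<^sup>2 + \<delta>\<^sup>2) powr (- \<alpha> / 4),
           r powr ((\<alpha> + 4) / 2) * (r\<^sup>2 + \<delta>\<^sup>2) powr (- (\<alpha> + 4) / 4)
             * (u\<^sup>2 + \<alpha> / 2 * v\<^sup>2 - \<alpha>),
           (\<alpha> - 2) / 2 * r powr ((\<alpha> + 4) / 2) * (r\<^sup>2 + \<delta>\<^sup>2) powr (- (\<alpha> + 4) / 4)
             * u * v))"

lemma reduced_field_eq:
  assumes "r > 0"
  shows "reduced_field \<alpha> \<delta> (r, v, u) =
    (v * r powr ((\<alpha> + 2) / 2) * (r\<^sup>2 + \<delta>\<^sup>2) powr (- \<alpha> / 4),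
     r powr ((\<alpha> + 4) / 2) * (r\<^sup>2 + \<delta>\<^sup>2) powr (- (\<alpha> + 4) / 4) * (u\<^sup>2 + \<alpha> / 2 * v\<^sup>2 - \<alpha>),
     (\<alpha> - 2) / 2 * r powr ((\<alpha> + 4) / 2) * (r\<^sup>2 + \<delta>\<^sup>2) powr (- (\<alpha> + 4) / 4) * u * v)"
proof (cases "\<delta> = 0")
  case True
  have sq: "(r\<^sup>2) powr a = r powr (2 * a)" for a
    using assms by (simp add: powr_powr flip: powr_numeral)
  have 1: "r powr ((\<alpha> + 2) / 2) * (r\<^sup>2) powr (- \<alpha> / 4) = r"
  proof -
    have "(\<alpha> + 2) / 2 + 2 * (- \<alpha> / 4) = 1" by (simp add: field_simps)
    then show ?thesis using assms unfolding sq powr_add[symmetric] by simp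
  qed
  have 2: "r powr ((\<alpha> + 4) / 2) * (r\<^sup>2) powr (- (\<alpha> + 4) / 4) = 1"
  proof -
    have "(\<alpha> + 4) / 2 + 2 * (- (\<alpha> + 4) / 4) = 0" by (simp add: field_simps)
    then show ?thesis using assms unfolding sq powr_add[symmetric] by simp
  qed
  have "v * r powr ((\<alpha> + 2) / 2) * (r\<^sup>2) powr (- \<alpha> / 4) = r * v"
    using 1 by (metis mult.assoc mult.commute)
  moreover have "(\<alpha> - 2) / 2 * r powr ((\<alpha> + 4) / 2) * (r\<^sup>2) powr (- (\<alpha> + 4) / 4) = (\<alpha> - 2) / 2"
    using 2 by (metis mult.assoc mult.right_neutral)
  ultimately show ?thesis using True 2 unfolding reduced_field_def by auto
qed (simp add: reduced_field_def)

definition reduced_flow :: "real \<Rightarrow> real \<Rightarrow> real \<Rightarrow> state \<Rightarrow> state" where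
  "reduced_flow \<alpha> \<delta> = flow_of (reduced_field \<alpha> \<delta>) phase_space"

definition energy_surface :: "real \<Rightarrow> real \<Rightarrow> real \<Rightarrow> state set" where
  "energy_surface \<alpha> h \<delta> =
     {(r, v, u). r \<ge> 0 \<and> u\<^sup>2 + v\<^sup>2 = 2 * (1 - \<bar>h\<bar> * (r\<^sup>2 + \<delta>\<^sup>2) powr (\<alpha> / 2))}"

definition energy_surface_pos :: "real \<Rightarrow> real \<Rightarrow> real \<Rightarrow> state set" where
  "energy_surface_pos \<alpha> h \<delta> = {(r, v, u). (r, v, u) \<in> energy_surface \<alpha> h \<delta> \<and> r > 0}"

end

theory Submission
  imports Defs
begin

text \<open>With \<open>\<rho> = sqrt (r\<^sup>2 + \<delta>\<^sup>2)\<close> the smoothed equations are the non-smoothed ones in \<open>(\<rho>, v, u)\<close> up to a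
  change of speed, and for every \<open>\<delta>\<close> the energy surface is invariant because \<open>r\<close> and the energy
  defect solve homogeneous linear equations. For \<open>r > 0\<close> the energy relation gives \<open>v' < 0\<close>, so no
  orbit is periodic; \<open>v'\<close> is bounded away from zero while \<open>r\<close> is, but \<open>v\<close> is bounded, so \<open>v\<close> turns
  negative and then \<open>r\<close> decreases to \<open>0\<close>. Reversing time by \<open>v \<mapsto> - v\<close> gives the limit at
  \<open>- \<infinity>\<close>. Hence every orbit crosses \<open>v = 0\<close> exactly once. This section is an open interval for
  both values of \<open>\<delta>\<close>, and both flows are conjugate to translation on its product with the time
  axis.\<close>

section \<open>Globally Lipschitz vector fields\<close>

text \<open>The substitution \<open>\<rho> = sqrt (r\<^sup>2 + \<delta>\<^sup>2)\<close> does not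
  itself give the equivalence: it carries the smoothed surface only onto the part \<rho> >
  \<epsilon> of the non-smoothed one. Matching orbits through their crossing of v = 0 avoids this.
  The bound on \<epsilon> enters only here: the section is |u| < c with c^2 = 2(1 - |h|
  |\<delta>|^\<alpha>), and the bound makes it nonempty for \<delta> = \<epsilon>. The flow has to
  be constructed before orbits can be discussed, and the field is not globally Lipschitz. The energy
  surface is bounded, so the field is multiplied by a cutoff equal to 1 there. A cutoff only changes
  the speed; the linear equations for r and the energy defect keep the same shape, so solutions of
  the cutoff field that start on the surface stay on it and solve the original equation for all
  time. The same equations confine every competing curve to the surface. The hypothesis \<alpha>
  \<ge> 2 acts twice: the power \<alpha>/2 \<ge> 1 of r/\<rho> is Lipschitz at r = 0, and \<alpha>/2
  - 1 \<ge> 0 fixes the sign of v'.\<close>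

lemma has_vector_derivative_reflect:
  fixes x :: "real \<Rightarrow> 'a::real_normed_vector"
  assumes "(x has_vector_derivative d) (at (- t))"
  shows "((\<lambda>s. x (- s)) has_vector_derivative - d) (at t)"
proof -
  have "((\<lambda>s. - s) has_vector_derivative - 1) (at t)"
    by (auto intro!: derivative_eq_intros)
  from vector_diff_chain_at[OF this, of x d] assms show ?thesis
    by (simp add: o_def)
qed

lemma has_vector_derivative_shift:
  fixes x :: "real \<Rightarrow> 'a::real_normed_vector"
  assumes "(x has_vector_derivative d) (at (t + a))"
  shows "((\<lambda>s. x (s + a)) has_vector_derivative d) (at t)"
proof -
  have "((\<lambda>s. s + a) has_vector_derivative 1) (at t)"
    by (auto intro!: derivative_eq_intros)
  from vector_diff_chain_at[OF this, of x d] assms show ?thesis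
    by (simp add: o_def)
qed

text \<open>The squared distance of the two solutions times \<open>exp (- 2 * L * s)\<close> is decreasing.\<close>

lemma dist_solutions_le_forward:
  fixes F :: "'a::real_inner \<Rightarrow> 'a"
  assumes lip: "L-lipschitz_on S F" and "0 \<le> t"
    and x: "\<And>s. s \<in> {0..t} \<Longrightarrow> x s \<in> S \<and> (x has_vector_derivative F (x s)) (at s)"
    and y: "\<And>s. s \<in> {0..t} \<Longrightarrow> y s \<in> S \<and> (y has_vector_derivative F (y s)) (at s)"
  shows "dist (x t) (y t) \<le> exp (L * t) * dist (x 0) (y 0)"
proof -
  define z where "z s = x s - y s" for s
  define w where "w s = (z s \<bullet> z s) * exp (- 2 * L * s)" for s
  have "w t \<le> w 0"
  proof (rule DERIV_nonpos_imp_nonincreasing[OF \<open>0 \<le> t\<close>])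
    fix s assume "0 \<le> s" "s \<le> t"
    then have xs: "x s \<in> S" "(x has_vector_derivative F (x s)) (at s)"
      and ys: "y s \<in> S" "(y has_vector_derivative F (y s)) (at s)"
      using x[of s] y[of s] by auto
    define d where "d = F (x s) - F (y s)"
    have "(z has_vector_derivative d) (at s)"
      unfolding z_def d_def using xs ys by (intro derivative_intros)
    then have "((\<lambda>s. z s \<bullet> z s) has_derivative (\<lambda>h. z s \<bullet> (h *\<^sub>R d) + (h *\<^sub>R d) \<bullet> z s)) (at s)"
      unfolding has_vector_derivative_def by (intro derivative_intros)
    then have "((\<lambda>s. z s \<bullet> z s) has_real_derivative 2 * (z s \<bullet> d)) (at s)"
      unfolding has_field_derivative_def
      by (rule has_derivative_eq_rhs) (auto simp: fun_eq_iff inner_commute)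
    then have "(w has_real_derivative 2 * (z s \<bullet> d) * exp (- 2 * L * s)
        + (z s \<bullet> z s) * (exp (- 2 * L * s) * (- 2 * L))) (at s)"
      unfolding w_def by (auto intro!: derivative_eq_intros)
    moreover have "z s \<bullet> d \<le> L * (z s \<bullet> z s)"
    proof -
      have "norm d \<le> L * norm (z s)"
        unfolding d_def z_def by (rule lipschitz_on_normD[OF lip xs(1) ys(1)])
      then have "norm (z s) * norm d \<le> norm (z s) * (L * norm (z s))"
        by (rule mult_left_mono) simp
      with norm_cauchy_schwarz[of "z s" d] show ?thesis
        by (simp add: dot_square_norm power2_eq_square mult_ac)
    qed
    then have "(z s \<bullet> d) * exp (- 2 * L * s) \<le> (L * (z s \<bullet> z s)) * exp (- 2 * L * s)"
      by (intro mult_right_mono) auto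
    then have "2 * (z s \<bullet> d) * exp (- 2 * L * s)
        + (z s \<bullet> z s) * (exp (- 2 * L * s) * (- 2 * L)) \<le> 0"
      by (simp add: algebra_simps)
    ultimately show "\<exists>m. (w has_real_derivative m) (at s) \<and> m \<le> 0" by blast
  qed
  then have "(z t \<bullet> z t) * exp (- 2 * L * t) * exp (2 * L * t) \<le> (z 0 \<bullet> z 0) * exp (2 * L * t)"
    unfolding w_def by (intro mult_right_mono) auto
  then have "(norm (z t))\<^sup>2 \<le> (norm (z 0))\<^sup>2 * exp (2 * L * t)"
    by (simp add: dot_square_norm mult.assoc flip: exp_add)
  also have "\<dots> = (exp (L * t) * norm (z 0))\<^sup>2"
    by (simp add: power_mult_distrib flip: exp_double)
  finally have "norm (z t) \<le> exp (L * t) * norm (z 0)"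
    by (rule power2_le_imp_le) simp
  then show ?thesis by (simp add: z_def dist_norm)
qed

text \<open>Negative times follow by reversing time, which turns \<open>F\<close> into
  \<open>- F\<close> with the same Lipschitz constant. Equal initial points give uniqueness on any
  interval around 0; different ones give continuous dependence.\<close>

lemma dist_solutions_le:
  fixes F :: "'a::real_inner \<Rightarrow> 'a"
  assumes lip: "L-lipschitz_on S F" and I: "is_interval I" "0 \<in> I" "t \<in> I"
    and x: "\<And>s. s \<in> I \<Longrightarrow> x s \<in> S \<and> (x has_vector_derivative F (x s)) (at s)"
    and y: "\<And>s. s \<in> I \<Longrightarrow> y s \<in> S \<and> (y has_vector_derivative F (y s)) (at s)"
  shows "dist (x t) (y t) \<le> exp (L * \<bar>t\<bar>) * dist (x 0) (y 0)"
proof (cases "0 \<le> t")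
  case True
  have "s \<in> I" if "s \<in> {0..t}" for s
    using mem_is_interval_1_I[OF I, of s] that by simp
  then have "dist (x t) (y t) \<le> exp (L * t) * dist (x 0) (y 0)"
    using x y by (intro dist_solutions_le_forward[OF lip True]) blast+
  then show ?thesis using True by simp
next
  case False
  have mem: "- s \<in> I" if "s \<in> {0..- t}" for s
    using mem_is_interval_1_I[OF I(1) I(3,2), of "- s"] that by simp
  have lip': "L-lipschitz_on S (\<lambda>z. - F z)" using lip by simp
  have "dist (x (- (- t))) (y (- (- t))) \<le> exp (L * - t) * dist (x (- 0)) (y (- 0))"
    using x[OF mem] y[OF mem] False
    by (intro dist_solutions_le_forward[OF lip'] conjI has_vector_derivative_reflect) auto
  then show ?thesis using False by simp
qed

text \<open>Integrating C exp(K|s|) from 0 gains a factor 1/K. This gain turns a Lipschitz constant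
  L into the contraction factor L/K.\<close>

lemma norm_antiderivative_le_exp:
  fixes A :: "real \<Rightarrow> 'a::real_normed_vector"
  assumes A: "A 0 = 0" "\<And>t. (A has_vector_derivative f t) (at t)"
    and K: "K > 0" and C: "C \<ge> 0" and f: "\<And>t. norm (f t) \<le> C * exp (K * \<bar>t\<bar>)"
  shows "norm (A t) \<le> C / K * exp (K * \<bar>t\<bar>)"
proof -
  have *: "norm (A t) \<le> C / K * exp (K * t)"
    if "t \<ge> 0" "A 0 = 0" "\<And>t. (A has_vector_derivative f t) (at t)"
      "\<And>t. norm (f t) \<le> C * exp (K * \<bar>t\<bar>)" for A f t
  proof (cases "t = 0")
    case False
    have "norm (A t - A 0) \<le> C / K * exp (K * t) - C / K * exp (K * 0)"
    proof (rule differentiable_bound_general)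
      show "0 < t" using that False by auto
      show "continuous_on {0..t} A"
        using that(3) by (meson continuous_at_imp_continuous_on has_vector_derivative_continuous)
      show "continuous_on {0..t} (\<lambda>s. C / K * exp (K * s))" by (intro continuous_intros)
      fix s assume "0 < s" "s < t"
      show "(A has_vector_derivative f s) (at s)" by (rule that)
      show "((\<lambda>s. C / K * exp (K * s)) has_vector_derivative C * exp (K * s)) (at s)"
        using K by (auto intro!: derivative_eq_intros
            simp flip: has_real_derivative_iff_has_vector_derivative)
      show "norm (f s) \<le> C * exp (K * s)" using that(4)[of s] \<open>0 < s\<close> by simp
    qed
    also have "\<dots> \<le> C / K * exp (K * t)" using K C by simp
    finally show ?thesis using that by simp
  qed (use that C K in simp)
  show ?thesis
  proof (cases "t \<ge> 0")
    case True
    then show ?thesis using *[of t A f] A f by auto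
  next
    case False
    have "norm (- f (- t)) \<le> C * exp (K * \<bar>t\<bar>)" for t using f[of "- t"] by simp
    then show ?thesis
      using *[of "- t" "\<lambda>s. A (- s)" "\<lambda>s. - f (- s)"] A False
      by (auto intro!: has_vector_derivative_reflect)
  qed
qed

text \<open>Picard iteration on the whole time axis: in the weighted unknown \<open>exp (- K * \<bar>t\<bar>) *\<^sub>R x t\<close>
  with \<open>K > L\<close> the integral operator is a contraction of the bounded continuous functions.\<close>

lemma lipschitz_solution_exists:
  fixes F :: "'a::euclidean_space \<Rightarrow> 'a"
  assumes lip: "L-lipschitz_on UNIV F"
  shows "\<exists>x. x 0 = x0 \<and> (\<forall>t. (x has_vector_derivative F (x t)) (at t))"
proof -
  have "L \<ge> 0" using lip by (rule lipschitz_on_nonneg)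
  \<comment> \<open>The factor 2 makes the contraction factor L/K at most 1/2; the summand 1 keeps
    \<open>K\<close> positive when \<open>L = 0\<close>.\<close>
  define K where "K = 2 * L + 1"
  have K: "K > 0" "L / K \<le> 1 / 2" using \<open>L \<ge> 0\<close> by (auto simp: K_def field_simps)
  define e where "e t = exp (K * \<bar>t\<bar>)" for t
  have e: "e t > 0" "e t \<ge> 1" "e 0 = 1" for t using K by (auto simp: e_def)
  have e_cont: "continuous_on UNIV e" unfolding e_def by (intro continuous_intros)
  have F_cont: "continuous_on UNIV F" by (rule lipschitz_on_continuous_on[OF lip])
  define y where "y z t = F (e t *\<^sub>R apply_bcontfun z t)" for z :: "real \<Rightarrow>\<^sub>C 'a" and t
  have y_cont: "continuous_on UNIV (y z)" for z
    unfolding y_def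
    by (intro continuous_on_compose2[OF F_cont] continuous_intros e_cont) auto
  \<comment> \<open>The integral from 0 to t, for either sign of t, is represented by the
    antiderivative that vanishes at 0.\<close>
  have "\<exists>A. A 0 = 0 \<and> (\<forall>t. (A has_vector_derivative y z t) (at t))" for z
  proof -
    have "isCont (y z) t" for t using y_cont[of z] by (simp add: continuous_on_eq_continuous_at)
    then obtain A where "\<And>t. (A has_vector_derivative y z t) (at t)"
      using einterval_antiderivative[of "-\<infinity>" "\<infinity>" "y z"] by auto
    then have "((\<lambda>t. A t - A 0) has_vector_derivative y z t) (at t)" for t
      by (auto intro!: derivative_eq_intros)
    then show ?thesis by (intro exI[of _ "\<lambda>t. A t - A 0"]) auto
  qed
  then obtain J where J0: "\<And>z. J z 0 = 0"
    and J: "\<And>z t. (J z has_vector_derivative y z t) (at t)" by metis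
  have J_cont: "continuous_on UNIV (J z)" for z
    using J by (meson continuous_at_imp_continuous_on has_vector_derivative_continuous)
  \<comment> \<open>The Picard operator in the weighted unknown: \<open>P z = z\<close> says that
    \<open>x t = e t *\<^sub>R z t\<close> satisfies \<open>x t = x0 + J z t\<close>, the integral
    equation.\<close>
  define P where "P z t = (1 / e t) *\<^sub>R (x0 + J z t)" for z t
  have "P z \<in> bcontfun" for z
  proof (rule bcontfun_normI)
    show "continuous_on UNIV (P z)"
      unfolding P_def using e(1)
      by (intro continuous_intros e_cont J_cont) (simp add: less_imp_neq[symmetric])
    have yb: "norm (y z t) \<le> (norm (F 0) + L * norm z) * exp (K * \<bar>t\<bar>)" for t
    proof -
      have "norm (y z t) \<le> norm (F 0) + norm (F (e t *\<^sub>R z t) - F 0)"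
        unfolding y_def by (metis add.commute diff_add_cancel norm_triangle_ineq)
      also have "norm (F (e t *\<^sub>R z t) - F 0) \<le> L * (e t * norm (z t))"
        using lipschitz_on_normD[OF lip, of "e t *\<^sub>R z t" 0] e(1)[of t] by simp
      also have "\<dots> \<le> L * (e t * norm z)"
        using \<open>L \<ge> 0\<close> e(1)[of t] norm_bounded[of z t] by (intro mult_left_mono) auto
      also have "norm (F 0) \<le> norm (F 0) * e t" using e(2)[of t] by (simp add: mult_le_cancel_left1)
      finally show ?thesis by (simp add: e_def algebra_simps)
    qed
    fix t
    have "norm (J z t) \<le> (norm (F 0) + L * norm z) / K * e t"
      unfolding e_def
      by (rule norm_antiderivative_le_exp[OF J0 J K(1) _ yb]) (use \<open>L \<ge> 0\<close> in simp)
    moreover have "norm x0 \<le> norm x0 * e t" using e(2)[of t] by (simp add: mult_le_cancel_left1)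
    ultimately have "norm (x0 + J z t) \<le> (norm x0 + (norm (F 0) + L * norm z) / K) * e t"
      by (intro order_trans[OF norm_triangle_ineq]) (simp add: distrib_right)
    then show "norm (P z t) \<le> norm x0 + (norm (F 0) + L * norm z) / K"
      unfolding P_def using e(1)[of t] by (simp add: pos_divide_le_eq)
  qed
  then have P: "apply_bcontfun (Bcontfun (P z)) = P z" for z by (simp add: Bcontfun_inverse)
  have "\<exists>!z. Bcontfun (P z) = z"
  proof (rule banach_fix_type)
    show "0 \<le> (1 / 2 :: real)" "1 / 2 < (1 :: real)" by auto
    show "\<forall>z w. dist (Bcontfun (P z)) (Bcontfun (P w)) \<le> 1 / 2 * dist z w"
    proof (intro allI dist_bound)
      fix z w :: "real \<Rightarrow>\<^sub>C 'a" and t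
      have "norm (J z t - J w t) \<le> L * dist z w / K * exp (K * \<bar>t\<bar>)"
      proof (rule norm_antiderivative_le_exp)
        show "((\<lambda>t. J z t - J w t) has_vector_derivative (y z t - y w t)) (at t)" for t
          by (intro derivative_intros J)
        fix t
        have "norm (y z t - y w t) \<le> L * norm (e t *\<^sub>R z t - e t *\<^sub>R w t)"
          unfolding y_def by (rule lipschitz_on_normD[OF lip]) auto
        also have "\<dots> = L * (e t * dist (z t) (w t))"
          using e(1)[of t] by (simp add: dist_norm flip: scaleR_diff_right)
        also have "\<dots> \<le> L * (e t * dist z w)"
          using \<open>L \<ge> 0\<close> e(1)[of t] dist_bounded[of z t w] by (intro mult_left_mono) auto
        finally show "norm (y z t - y w t) \<le> L * dist z w * exp (K * \<bar>t\<bar>)"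
          by (simp add: e_def mult_ac)
      qed (use J0 K \<open>L \<ge> 0\<close> in auto)
      also have "\<dots> = L / K * (dist z w * e t)" by (simp add: e_def)
      also have "\<dots> \<le> 1 / 2 * (dist z w * e t)"
        using K e(1)[of t] by (intro mult_right_mono) auto
      finally have "norm (J z t - J w t) / e t \<le> 1 / 2 * dist z w"
        using e(1)[of t] by (simp add: pos_divide_le_eq)
      moreover have "P z t - P w t = (1 / e t) *\<^sub>R (J z t - J w t)"
        by (simp add: P_def algebra_simps)
      ultimately show "dist (Bcontfun (P z) t) (Bcontfun (P w) t) \<le> 1 / 2 * dist z w"
        using e(1)[of t] by (simp add: P dist_norm)
    qed
  qed
  then obtain z where "Bcontfun (P z) = z" by blast
  then have z: "apply_bcontfun z = P z" using P by metis
  define x where "x t = x0 + J z t" for t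
  have "e t *\<^sub>R z t = x t" for t using e(1)[of t] by (simp add: z P_def x_def)
  then have "(x has_vector_derivative F (x t)) (at t)" for t
    using J[of z t] unfolding y_def x_def by (auto intro!: derivative_eq_intros)
  then show ?thesis using J0 by (intro exI[of _ x]) (simp add: x_def)
qed

text \<open>Existence comes from the globally Lipschitz \<open>G\<close>, whose solutions never
  leave \<open>S\<close>. Uniqueness concerns curves of \<open>F\<close> in \<open>P\<close>:
  \<open>inv_F\<close> confines them to \<open>S\<close>, where \<open>F\<close> and
  \<open>G\<close> agree, so they are compared as solutions of \<open>G\<close>.\<close>

lemma generates_flow_onI:
  fixes F G :: "'a::euclidean_space \<Rightarrow> 'a"
  assumes lip: "L-lipschitz_on UNIV G" and SP: "S \<subseteq> P" and eq: "\<And>x. x \<in> S \<Longrightarrow> G x = F x"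
    and inv_G: "\<And>x t. x 0 \<in> S \<Longrightarrow> (\<And>t. (x has_vector_derivative G (x t)) (at t)) \<Longrightarrow> x t \<in> S"
    and inv_F: "\<And>I \<phi> t. integral_curve F P I \<phi> \<Longrightarrow> \<phi> 0 \<in> S \<Longrightarrow> t \<in> I \<Longrightarrow> \<phi> t \<in> S"
  shows "generates_flow_on F P S"
proof -
  have "\<exists>x. x 0 = x0 \<and> (\<forall>t. (x has_vector_derivative G (x t)) (at t))" for x0
    by (rule lipschitz_solution_exists[OF lip])
  then obtain X where X0: "\<And>x. X x 0 = x"
    and X: "\<And>x t. (X x has_vector_derivative G (X x t)) (at t)" by metis
  have XS: "X x t \<in> S" if "x \<in> S" for x t
    by (rule inv_G) (use that X0 X in auto)
  have curve: "integral_curve F P UNIV (X x)" if "x \<in> S" for x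
    unfolding integral_curve_def using XS[OF that] X[of x] SP by (auto simp flip: eq)
  have unique: "\<phi> t = X (\<phi> 0) t" if \<phi>: "integral_curve F P I \<phi>" "\<phi> 0 \<in> S" and t: "t \<in> I" for I \<phi> t
  proof -
    have I: "is_interval I" "0 \<in> I" using \<phi>(1) by (auto simp: integral_curve_def)
    have "(\<phi> has_vector_derivative G (\<phi> s)) (at s)" if "s \<in> I" for s
      using \<phi>(1) that inv_F[OF \<phi> that] by (auto simp: integral_curve_def eq)
    then have "dist (\<phi> t) (X (\<phi> 0) t) \<le> exp (L * \<bar>t\<bar>) * dist (\<phi> 0) (X (\<phi> 0) 0)"
      using X by (intro dist_solutions_le[OF lip I t]) auto
    then show ?thesis by (simp add: X0)
  qed
  have flow: "flow_of F P t x = X x t" if "x \<in> S" for x t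
    unfolding flow_of_def
  proof (rule the_equality)
    show "\<exists>I \<phi>. integral_curve F P I \<phi> \<and> \<phi> 0 = x \<and> t \<in> I \<and> \<phi> t = X x t"
      using curve[OF that] X0 by blast
    show "y = X x t" if "\<exists>I \<phi>. integral_curve F P I \<phi> \<and> \<phi> 0 = x \<and> t \<in> I \<and> \<phi> t = y" for y
      using unique that \<open>x \<in> S\<close> by blast
  qed
  have "flow_of F P (s + t) x = flow_of F P s (flow_of F P t x)" if "x \<in> S" for s t x
  proof -
    have "integral_curve F P UNIV (\<lambda>s. X x (s + t))"
      using curve[OF that] unfolding integral_curve_def
      by (auto intro!: has_vector_derivative_shift)
    from unique[OF this, of s] show ?thesis by (simp add: flow XS that)
  qed
  moreover have "continuous_on (UNIV \<times> S) (\<lambda>(t, x). flow_of F P t x)"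
  proof -
    have "continuous (at (t, x) within UNIV \<times> S) (\<lambda>(t, x). X x t)" for t x
    proof -
      \<comment> \<open>Joint continuity by an intermediate point: the starting point is changed at
        a fixed time, which the exponential estimate controls, and then time varies along the single
        solution through \<open>x\<close>.\<close>
      have "((\<lambda>q. exp (L * \<bar>fst q\<bar>) * dist (snd q) x + dist (X x (fst q)) (X x t)) \<longlongrightarrow>
          exp (L * \<bar>t\<bar>) * dist x x + dist (X x t) (X x t)) (at (t, x) within UNIV \<times> S)"
      proof (intro tendsto_intros)
        have "isCont (X x) t" using X by (rule has_vector_derivative_continuous)
        moreover have "(fst \<longlongrightarrow> t) (at (t, x) within UNIV \<times> S)"
          using tendsto_fst[OF tendsto_ident_at, of "(t, x)"] by simp
        ultimately show "((\<lambda>q. X x (fst q)) \<longlongrightarrow> X x t) (at (t, x) within UNIV \<times> S)"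
          by (rule isCont_tendsto_compose)
        show "(fst \<longlongrightarrow> t) (at (t, x) within UNIV \<times> S)"
          using tendsto_fst[OF tendsto_ident_at, of "(t, x)"] by simp
        show "(snd \<longlongrightarrow> x) (at (t, x) within UNIV \<times> S)"
          using tendsto_snd[OF tendsto_ident_at, of "(t, x)"] by simp
      qed
      then have lim: "((\<lambda>q. exp (L * \<bar>fst q\<bar>) * dist (snd q) x + dist (X x (fst q)) (X x t)) \<longlongrightarrow> 0)
          (at (t, x) within UNIV \<times> S)" by simp
      have "((\<lambda>q. dist (X (snd q) (fst q)) (X x t)) \<longlongrightarrow> 0) (at (t, x) within UNIV \<times> S)"
      proof (rule tendsto_sandwich[OF _ _ tendsto_const lim]; intro always_eventually allI)
        fix q :: "real \<times> 'a"
        have "dist (X (snd q) (fst q)) (X x (fst q)) \<le>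
            exp (L * \<bar>fst q\<bar>) * dist (X (snd q) 0) (X x 0)"
          using X by (intro dist_solutions_le[OF lip is_interval_univ]) auto
        then show "dist (X (snd q) (fst q)) (X x t) \<le>
            exp (L * \<bar>fst q\<bar>) * dist (snd q) x + dist (X x (fst q)) (X x t)"
          by (simp add: X0) (meson add_mono dist_triangle order_refl order_trans)
      qed simp
      then show ?thesis
        unfolding continuous_within split_beta fst_conv snd_conv by (rule tendsto_dist_iff[THEN iffD2])
    qed
    then have "continuous_on (UNIV \<times> S) (\<lambda>(t, x). X x t)"
      by (auto simp: continuous_on_eq_continuous_within)
    then show ?thesis
      by (rule continuous_on_eq) (auto simp: flow)
  qed
  ultimately have "flow_on S (flow_of F P)"
    using XS unfolding flow_on_def by (auto simp: flow X0)
  moreover have "integral_curve F P UNIV (\<lambda>t. flow_of F P t x)" if "x \<in> S" for x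
    using curve[OF that] by (simp add: flow[OF that])
  ultimately show ?thesis
    using SP unique flow unfolding generates_flow_on_def by auto
qed

section \<open>Flows with a global cross section\<close>

text \<open>A global cross section encoded by a strict Lyapunov function: strict decrease makes the
  zero on each orbit unique, and the sign of \<open>V\<close> tells whether the crossing lies ahead
  or behind.\<close>

definition crosses_once :: "'a::topological_space set \<Rightarrow> (real \<Rightarrow> 'a \<Rightarrow> 'a) \<Rightarrow> ('a \<Rightarrow> real) \<Rightarrow> bool" where
  "crosses_once S \<Phi> V \<longleftrightarrow> flow_on S \<Phi> \<and> continuous_on S V \<and>
     (\<forall>x\<in>S. (\<forall>s t. s < t \<longrightarrow> V (\<Phi> t x) < V (\<Phi> s x)) \<and> (\<exists>t. V (\<Phi> t x) = 0))"

lemma continuous_on_flow: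
  assumes "flow_on S \<Phi>" "continuous_on A f" "continuous_on A g" "\<And>x. x \<in> A \<Longrightarrow> g x \<in> S"
  shows "continuous_on A (\<lambda>x. \<Phi> (f x) (g x))"
proof -
  have "continuous_on (UNIV \<times> S) (\<lambda>(t, x). \<Phi> t x)" using assms(1) by (simp add: flow_on_def)
  from continuous_on_compose2[OF this continuous_on_Pair[OF assms(2,3)]] show ?thesis
    using assms(4) by auto
qed

text \<open>The hitting time \<open>T\<close> is continuous because \<open>a < T x\<close> and \<open>T x < a\<close> are the open conditions
  \<open>V (\<Phi> a x) > 0\<close> and \<open>V (\<Phi> a x) < 0\<close>.\<close>

lemma hitting_time_exists:
  assumes "crosses_once S \<Phi> V"
  obtains T where "continuous_on S T" "\<And>x. x \<in> S \<Longrightarrow> V (\<Phi> (T x) x) = 0"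
    "\<And>x t. x \<in> S \<Longrightarrow> T (\<Phi> t x) = T x - t" "\<And>x. x \<in> S \<Longrightarrow> V x = 0 \<Longrightarrow> T x = 0"
proof -
  have flow: "flow_on S \<Phi>" and V: "continuous_on S V"
    and dec: "\<And>x s t. x \<in> S \<Longrightarrow> s < t \<Longrightarrow> V (\<Phi> t x) < V (\<Phi> s x)"
    and "\<And>x. x \<in> S \<Longrightarrow> \<exists>t. V (\<Phi> t x) = 0"
    using assms by (auto simp: crosses_once_def)
  then obtain T where T: "\<And>x. x \<in> S \<Longrightarrow> V (\<Phi> (T x) x) = 0" by metis
  have mem: "\<Phi> t x \<in> S" and zero: "\<Phi> 0 x = x" and add: "\<Phi> (s + t) x = \<Phi> s (\<Phi> t x)"
    if "x \<in> S" for s t x using flow that by (auto simp: flow_on_def)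
  have less: "a < T x \<longleftrightarrow> 0 < V (\<Phi> a x)" and greater: "T x < a \<longleftrightarrow> V (\<Phi> a x) < 0"
    if "x \<in> S" for a x
    using dec[OF that, of a "T x"] dec[OF that, of "T x" a] T[OF that]
    by (cases a "T x" rule: linorder_cases; simp)+
  have eq: "T x = a" if "x \<in> S" "V (\<Phi> a x) = 0" for a x
    using less[of x a] greater[of x a] that by force
  have cont: "continuous_on S (\<lambda>x. V (\<Phi> a x))" for a
    by (rule continuous_on_compose2[OF V])
      (use mem in \<open>auto intro!: continuous_on_flow[OF flow] continuous_intros\<close>)
  have "continuous_on S T"
    unfolding continuous_on_def
  proof (intro ballI order_tendstoI)
    fix x a assume "x \<in> S"
    then have lim: "((\<lambda>y. V (\<Phi> a y)) \<longlongrightarrow> V (\<Phi> a x)) (at x within S)"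
      using cont[of a] by (auto simp: continuous_on_def)
    have S: "\<forall>\<^sub>F y in at x within S. y \<in> S" by (auto simp: eventually_at_filter)
    show "\<forall>\<^sub>F y in at x within S. a < T y" if "a < T x"
    proof -
      have "\<forall>\<^sub>F y in at x within S. 0 < V (\<Phi> a y)"
        using that less[OF \<open>x \<in> S\<close>] by (intro order_tendstoD[OF lim]) auto
      with S show ?thesis by eventually_elim (simp add: less)
    qed
    show "\<forall>\<^sub>F y in at x within S. T y < a" if "T x < a"
    proof -
      have "\<forall>\<^sub>F y in at x within S. V (\<Phi> a y) < 0"
        using that greater[OF \<open>x \<in> S\<close>] by (intro order_tendstoD[OF lim]) auto
      with S show ?thesis by eventually_elim (simp add: greater)
    qed
  qed
  moreover have "T (\<Phi> t x) = T x - t" if "x \<in> S" for x t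
    using that T[OF that] by (intro eq mem) (simp_all flip: add)
  moreover have "T x = 0" if "x \<in> S" "V x = 0" for x
    using that by (intro eq) (simp_all add: zero)
  ultimately show ?thesis using that T by blast
qed

text \<open>A point is determined by its crossing point and its hitting time. The homeomorphism
  moves the crossing point by \<open>k\<close> and keeps the hitting time, so it is even a conjugacy
  and the time change is the identity.\<close>

lemma crosses_once_topologically_equivalent:
  assumes S: "crosses_once S \<Phi> V" and S': "crosses_once S' \<Psi> W"
    and hom: "{x \<in> S. V x = 0} homeomorphic {y \<in> S'. W y = 0}"
  shows "topologically_equivalent S \<Phi> S' \<Psi>"
proof -
  \<comment> \<open>Stated for two arbitrary flows of arbitrary types, because it serves once for
    \<open>H\<close> and once, with the roles exchanged, for \<open>K\<close>.\<close>
  have transport: "continuous_on S (\<lambda>x. \<Psi> (- T x) (k (\<Phi> (T x) x)))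
      \<and> (\<forall>x\<in>S. \<Psi> (- T x) (k (\<Phi> (T x) x)) \<in> S' \<and>
          \<Phi> (- T' (\<Psi> (- T x) (k (\<Phi> (T x) x)))) (k' (\<Psi> (T' (\<Psi> (- T x) (k (\<Phi> (T x) x))))
            (\<Psi> (- T x) (k (\<Phi> (T x) x))))) = x)"
    if S: "flow_on S \<Phi>" and S': "flow_on S' \<Psi>"
      and k: "homeomorphism {x \<in> S. V x = 0} {y \<in> S'. W y = 0} k k'"
      and T: "continuous_on S T" "\<And>x. x \<in> S \<Longrightarrow> V (\<Phi> (T x) x) = 0"
      and T': "\<And>x t. x \<in> S' \<Longrightarrow> T' (\<Psi> t x) = T' x - t" "\<And>x. x \<in> S' \<Longrightarrow> W x = 0 \<Longrightarrow> T' x = 0"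
    for S :: "'c::topological_space set" and \<Phi> V and S' :: "'d::topological_space set" and \<Psi> W k k' T T'
  proof -
    note fl = S[unfolded flow_on_def] and fl' = S'[unfolded flow_on_def]
    have sec: "\<Phi> (T x) x \<in> {x \<in> S. V x = 0}" if "x \<in> S" for x
      using fl T(2) that by auto
    have k_mem: "k (\<Phi> (T x) x) \<in> S'" "W (k (\<Phi> (T x) x)) = 0" "k' (k (\<Phi> (T x) x)) = \<Phi> (T x) x"
      if "x \<in> S" for x
      using sec[OF that] k unfolding homeomorphism_def by blast+
    have k_cont: "continuous_on {x \<in> S. V x = 0} k" using k by (simp add: homeomorphism_def)
    have "continuous_on S (\<lambda>x. k (\<Phi> (T x) x))"
      by (rule continuous_on_compose2[OF k_cont])
        (use sec T(1) in \<open>auto intro!: continuous_on_flow[OF S] continuous_intros\<close>)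
    then have "continuous_on S (\<lambda>x. \<Psi> (- T x) (k (\<Phi> (T x) x)))"
      using k_mem T(1) by (intro continuous_on_flow[OF S'] continuous_intros) auto
    moreover have "\<Psi> (- T x) (k (\<Phi> (T x) x)) \<in> S'" if "x \<in> S" for x
      using k_mem[OF that] fl' by auto
    moreover have "\<Phi> (- T' (\<Psi> (- T x) (k (\<Phi> (T x) x)))) (k' (\<Psi> (T' (\<Psi> (- T x) (k (\<Phi> (T x) x))))
            (\<Psi> (- T x) (k (\<Phi> (T x) x))))) = x" if "x \<in> S" for x
    proof -
      let ?z = "k (\<Phi> (T x) x)"
      have "T' (\<Psi> (- T x) ?z) = T x" using T' k_mem[OF that] by simp
      moreover have "\<Psi> (T x) (\<Psi> (- T x) ?z) = ?z"
        using fl' k_mem(1)[OF that] by (metis add.right_inverse)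
      moreover have "\<Phi> (- T x) (\<Phi> (T x) x) = x"
        using fl that by (metis add.left_inverse)
      ultimately show ?thesis using k_mem(3)[OF that] by simp
    qed
    ultimately show ?thesis by blast
  qed
  obtain k k' where k: "homeomorphism {x \<in> S. V x = 0} {y \<in> S'. W y = 0} k k'"
    using hom by (auto simp: homeomorphic_def)
  have flow: "flow_on S \<Phi>" "flow_on S' \<Psi>" using S S' by (auto simp: crosses_once_def)
  obtain T where T: "continuous_on S T" "\<And>x. x \<in> S \<Longrightarrow> V (\<Phi> (T x) x) = 0"
    "\<And>x t. x \<in> S \<Longrightarrow> T (\<Phi> t x) = T x - t" "\<And>x. x \<in> S \<Longrightarrow> V x = 0 \<Longrightarrow> T x = 0"
    by (rule hitting_time_exists[OF S]) blast
  obtain T' where T': "continuous_on S' T'" "\<And>x. x \<in> S' \<Longrightarrow> W (\<Psi> (T' x) x) = 0"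
    "\<And>x t. x \<in> S' \<Longrightarrow> T' (\<Psi> t x) = T' x - t" "\<And>x. x \<in> S' \<Longrightarrow> W x = 0 \<Longrightarrow> T' x = 0"
    by (rule hitting_time_exists[OF S']) blast
  define H where "H x = \<Psi> (- T x) (k (\<Phi> (T x) x))" for x
  define K where "K y = \<Phi> (- T' y) (k' (\<Psi> (T' y) y))" for y
  have H: "continuous_on S H" "\<And>x. x \<in> S \<Longrightarrow> H x \<in> S'" "\<And>x. x \<in> S \<Longrightarrow> K (H x) = x"
    using transport[OF flow k T(1,2) T'(3,4)] unfolding H_def K_def by blast+
  have K: "continuous_on S' K" "\<And>y. y \<in> S' \<Longrightarrow> K y \<in> S" "\<And>y. y \<in> S' \<Longrightarrow> H (K y) = y"
    using transport[OF flow(2,1) homeomorphism_symD[OF k] T'(1,2) T(3,4)]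
    unfolding H_def K_def by blast+
  have "homeomorphism S S' H K"
    using H K by (intro homeomorphismI) auto
  moreover have conj: "H (\<Phi> t x) = \<Psi> t (H x)" if x: "x \<in> S" for t x
  proof -
    note fl = flow(1)[unfolded flow_on_def] and fl' = flow(2)[unfolded flow_on_def]
    have "\<Phi> (T x - t) (\<Phi> t x) = \<Phi> (T x) x"
      using fl x by (metis diff_add_cancel)
    then have "H (\<Phi> t x) = \<Psi> (t + - T x) (k (\<Phi> (T x) x))"
      by (simp add: H_def T(3)[OF x])
    also have "\<dots> = \<Psi> t (H x)"
    proof -
      have "\<Phi> (T x) x \<in> {x \<in> S. V x = 0}" using fl T(2) x by auto
      then have "k (\<Phi> (T x) x) \<in> S'" using k unfolding homeomorphism_def by blast
      then show ?thesis using fl' unfolding H_def by blast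
    qed
    finally show ?thesis .
  qed
  moreover have "H ` orbit \<Phi> x = orbit \<Psi> (H x)" if "x \<in> S" for x
    using conj[OF that] by (auto simp: orbit_def image_image)
  moreover have "strict_mono (\<lambda>t::real. t)" "surj (\<lambda>t::real. t)" by (auto simp: strict_mono_def)
  ultimately show ?thesis
    unfolding topologically_equivalent_def by (intro exI[of _ H] exI[of _ K]) blast
qed

section \<open>Bounded Lipschitz functions\<close>

text \<open>Products of Lipschitz functions may fail to be Lipschitz; the bounded ones form an
  algebra. Hence a polynomial expression in clamped coordinates is handled factor by factor.\<close>

definition bounded_lipschitz :: "('a::metric_space \<Rightarrow> real) \<Rightarrow> bool" where
  "bounded_lipschitz f \<longleftrightarrow> (\<exists>B. \<forall>x. \<bar>f x\<bar> \<le> B) \<and> (\<exists>L. L-lipschitz_on UNIV f)"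

lemma bounded_lipschitz_const: "bounded_lipschitz (\<lambda>x. c)"
  unfolding bounded_lipschitz_def using lipschitz_on_constant by blast

lemma bounded_lipschitz_add:
  assumes "bounded_lipschitz f" "bounded_lipschitz g"
  shows "bounded_lipschitz (\<lambda>x. f x + g x)"
proof -
  obtain B C K L where "\<And>x. \<bar>f x\<bar> \<le> B" "\<And>x. \<bar>g x\<bar> \<le> C"
    "K-lipschitz_on UNIV f" "L-lipschitz_on UNIV g"
    using assms by (auto simp: bounded_lipschitz_def)
  moreover from this have "\<bar>f x + g x\<bar> \<le> B + C" for x
    by (meson abs_triangle_ineq add_mono order_trans)
  ultimately show ?thesis
    unfolding bounded_lipschitz_def by (blast intro: lipschitz_on_add)
qed

lemma bounded_lipschitz_mult:
  assumes "bounded_lipschitz f" "bounded_lipschitz g"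
  shows "bounded_lipschitz (\<lambda>x. f x * g x)"
proof -
  obtain B C K L where B: "\<And>x. \<bar>f x\<bar> \<le> B" and C: "\<And>x. \<bar>g x\<bar> \<le> C"
    and K: "K-lipschitz_on UNIV f" and L: "L-lipschitz_on UNIV g"
    using assms by (auto simp: bounded_lipschitz_def)
  have nn: "B \<ge> 0" "C \<ge> 0" "K \<ge> 0" "L \<ge> 0"
    using B C abs_ge_zero order_trans lipschitz_on_nonneg K L by blast+
  have "(B * L + C * K)-lipschitz_on UNIV (\<lambda>x. f x * g x)"
  proof (rule lipschitz_onI)
    fix x y
    have "f x * g x - f y * g y = f x * (g x - g y) + g y * (f x - f y)"
      by (simp add: algebra_simps)
    then have "\<bar>f x * g x - f y * g y\<bar> \<le> \<bar>f x\<bar> * \<bar>g x - g y\<bar> + \<bar>g y\<bar> * \<bar>f x - f y\<bar>"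
      by (metis abs_mult abs_triangle_ineq)
    also have "\<dots> \<le> B * (L * dist x y) + C * (K * dist x y)"
      using B[of x] C[of y] lipschitz_onD[OF K, of x y] lipschitz_onD[OF L, of x y] nn
      by (intro add_mono mult_mono) (auto simp: dist_real_def)
    finally show "dist (f x * g x) (f y * g y) \<le> (B * L + C * K) * dist x y"
      by (simp add: dist_real_def algebra_simps)
  qed (use nn in simp)
  moreover have "\<bar>f x * g x\<bar> \<le> B * C" for x
    unfolding abs_mult using B[of x] C[of x] nn by (intro mult_mono) auto
  ultimately show ?thesis unfolding bounded_lipschitz_def by blast
qed

lemma bounded_lipschitz_diff:
  assumes "bounded_lipschitz f" "bounded_lipschitz g"
  shows "bounded_lipschitz (\<lambda>x. f x - g x)"
  using bounded_lipschitz_add[OF assms(1) bounded_lipschitz_mult[OF bounded_lipschitz_const assms(2)], of "- 1"]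
  by simp

lemma bounded_lipschitz_power2:
  assumes "bounded_lipschitz f"
  shows "bounded_lipschitz (\<lambda>x. (f x)\<^sup>2)"
  unfolding power2_eq_square by (rule bounded_lipschitz_mult[OF assms assms])

lemma bounded_lipschitz_compose:
  assumes "bounded_lipschitz f" "L-lipschitz_on UNIV p"
  shows "bounded_lipschitz (\<lambda>x. f (p x))"
proof -
  obtain B K where "\<And>x. \<bar>f x\<bar> \<le> B" and K: "K-lipschitz_on UNIV f"
    using assms(1) by (auto simp: bounded_lipschitz_def)
  moreover have "(K * L)-lipschitz_on UNIV (\<lambda>x. f (p x))"
    by (rule lipschitz_on_compose2[OF assms(2) lipschitz_on_subset[OF K]]) simp
  ultimately show ?thesis unfolding bounded_lipschitz_def by blast
qed

lemma bounded_lipschitz_clamp: "bounded_lipschitz (\<lambda>z::real. max a (min b z))"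
proof -
  have "\<bar>max a (min b z)\<bar> \<le> \<bar>a\<bar> + \<bar>b\<bar>" for z by (auto simp: max_def min_def)
  moreover have "1-lipschitz_on UNIV (\<lambda>z. max a (min b z))"
    by (rule lipschitz_onI) (auto simp: dist_real_def max_def min_def)
  ultimately show ?thesis unfolding bounded_lipschitz_def by blast
qed

lemma lipschitz_on_fst: "1-lipschitz_on UNIV fst"
  by (rule lipschitz_onI) (auto simp: dist_fst_le)

lemma lipschitz_on_snd: "1-lipschitz_on UNIV snd"
  by (rule lipschitz_onI) (auto simp: dist_snd_le)

lemma bounded_lipschitz_Pair:
  assumes "\<exists>L. L-lipschitz_on UNIV f" "\<exists>L. L-lipschitz_on UNIV g"
  shows "\<exists>L. L-lipschitz_on UNIV (\<lambda>x. (f x, g x))"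
  using assms by (blast intro: lipschitz_on_Pair)

lemma powr_lipschitz_on_unit_interval:
  fixes p :: real
  assumes "p \<ge> 1"
  shows "p-lipschitz_on {0..1} (\<lambda>x. x powr p)"
proof (rule lipschitz_on_leI)
  fix x y :: real assume xy: "x \<in> {0..1}" "y \<in> {0..1}" "x \<le> y"
  have "y powr p - x powr p \<le> p * (y - x)"
  \<comment> \<open>The derivative rule for \<open>powr\<close> is applied at positive points only,
    so \<open>x = 0\<close> is treated by direct comparison.\<close>
  proof (cases "x = 0 \<or> x = y")
    case True
    have "y powr p \<le> y powr 1"
      using assms xy powr_mono'[of 1 p y] by auto
    also have "\<dots> \<le> p * y" using assms xy by (simp add: mult_le_cancel_right1)
    finally show ?thesis using True by auto
  next
    case False
    then have "0 < x" "x < y" using xy by auto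
    then have "\<exists>z. x < z \<and> z < y \<and> y powr p - x powr p = (y - x) * (p * z powr (p - 1))"
      by (intro MVT2) (auto intro!: derivative_eq_intros)
    then obtain z where z: "x < z" "z < y" "y powr p - x powr p = (y - x) * (p * z powr (p - 1))"
      by blast
    have "z powr (p - 1) \<le> 1" using z xy assms by (intro powr_le1) auto
    then have "p * z powr (p - 1) \<le> p" using assms by (simp add: mult_le_cancel_left1)
    then show ?thesis using z \<open>x < y\<close> by (simp add: mult.commute mult_right_mono)
  qed
  moreover have "x powr p \<le> y powr p" using xy assms by (intro powr_mono2) auto
  ultimately show "dist (x powr p) (y powr p) \<le> p * dist x y"
    using xy by (simp add: dist_real_def)
qed (use assms in simp)

section \<open>The reduced field\<close>

text \<open>With \<open>\<rho> = sqrt (r\<^sup>2 + \<delta>\<^sup>2)\<close> and \<open>s = r / \<rho>\<close> the reduced field is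
  \<open>(r s\<^bsup>\<alpha>/2\<^esup> v, s\<^bsup>\<alpha>/2+2\<^esup> (u\<^sup>2 + \<alpha>/2 v\<^sup>2 - \<alpha>), s\<^bsup>\<alpha>/2+2\<^esup> (\<alpha>-2)/2 u v)\<close>. The absolute value extends
  it to \<open>r < 0\<close>, and the case distinction removes the junk value \<open>0 / 0 = 0\<close> at \<open>r = \<delta> = 0\<close>.\<close>

definition slope :: "real \<Rightarrow> real \<Rightarrow> real" where
  "slope \<delta> r = (if \<delta> = 0 then 1 else \<bar>r\<bar> / sqrt (r\<^sup>2 + \<delta>\<^sup>2))"

definition full_field :: "real \<Rightarrow> real \<Rightarrow> state \<Rightarrow> state" where
  "full_field \<alpha> \<delta> = (\<lambda>(r, v, u).
     (r * slope \<delta> r powr (\<alpha> / 2) * v,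
      slope \<delta> r powr (\<alpha> / 2 + 2) * (u\<^sup>2 + \<alpha> / 2 * v\<^sup>2 - \<alpha>),
      slope \<delta> r powr (\<alpha> / 2 + 2) * ((\<alpha> - 2) / 2 * u * v)))"

lemma radicand_pos: "\<delta> \<noteq> 0 \<Longrightarrow> 0 < r\<^sup>2 + (\<delta>::real)\<^sup>2"
  by (simp add: pos_add_strict sum_power2_gt_zero_iff)

lemma slope_bounds: "0 \<le> slope \<delta> r" "slope \<delta> r \<le> 1"
proof -
  show "0 \<le> slope \<delta> r" by (simp add: slope_def)
  have "\<bar>r\<bar> \<le> sqrt (r\<^sup>2 + \<delta>\<^sup>2)" by (rule real_le_rsqrt) simp
  then show "slope \<delta> r \<le> 1"
    using radicand_pos[of \<delta> r] by (simp add: slope_def divide_le_eq_1)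
qed

lemma slope_pos: "r \<noteq> 0 \<Longrightarrow> 0 < slope \<delta> r"
  using radicand_pos[of \<delta> r] by (simp add: slope_def)

lemma slope_sq: "r \<noteq> 0 \<Longrightarrow> (slope \<delta> r)\<^sup>2 * (r\<^sup>2 + \<delta>\<^sup>2) = r\<^sup>2"
  using radicand_pos[of \<delta> r] by (auto simp: slope_def power_divide)

text \<open>After squaring and cross-multiplying only r^2 \<delta>^2 \<le> r'^2 \<delta>^2 remains.
  It serves to bound the speed factor from below while r stays away from 0.\<close>

lemma slope_mono:
  assumes "0 < r" "r \<le> r'"
  shows "slope \<delta> r \<le> slope \<delta> r'"
proof (cases "\<delta> = 0")
  case False
  have "(r * sqrt (r'\<^sup>2 + \<delta>\<^sup>2))\<^sup>2 \<le> (r' * sqrt (r\<^sup>2 + \<delta>\<^sup>2))\<^sup>2"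
  proof -
    have "r\<^sup>2 * \<delta>\<^sup>2 \<le> r'\<^sup>2 * \<delta>\<^sup>2" using assms by (intro mult_right_mono power_mono) auto
    then show ?thesis by (simp add: power_mult_distrib distrib_left mult.commute)
  qed
  then have "r * sqrt (r'\<^sup>2 + \<delta>\<^sup>2) \<le> r' * sqrt (r\<^sup>2 + \<delta>\<^sup>2)"
    by (rule power2_le_imp_le) (use assms in simp)
  then show ?thesis
    using False assms radicand_pos[of \<delta> r] radicand_pos[of \<delta> r']
    by (simp add: slope_def divide_le_eq le_divide_eq)
qed (simp add: slope_def)

text \<open>Without the absolute value the function is smooth, with derivative \<delta>^2/\<rho>^3
  where \<rho> \<ge> |\<delta>| > 0, hence at most 1/|\<delta>|. Taking absolute values does not
  increase distances.\<close>

lemma slope_lipschitz: "\<exists>L. L-lipschitz_on UNIV (slope \<delta>)"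
proof (cases "\<delta> = 0")
  case True
  then have "slope \<delta> = (\<lambda>r. 1)" by (simp add: slope_def fun_eq_iff)
  then show ?thesis using lipschitz_on_constant by metis
next
  case False
  have "norm (x / sqrt (x\<^sup>2 + \<delta>\<^sup>2) - y / sqrt (y\<^sup>2 + \<delta>\<^sup>2)) \<le> 1 / \<bar>\<delta>\<bar> * norm (x - y)" for x y
  proof (rule field_differentiable_bound[where S = UNIV])
    fix r
    let ?q = "sqrt (r\<^sup>2 + \<delta>\<^sup>2)"
    note D = radicand_pos[OF False, of r]
    have q: "?q > 0" "?q\<^sup>2 = r\<^sup>2 + \<delta>\<^sup>2"
      using D by (simp_all only: real_sqrt_gt_0_iff real_sqrt_pow2 less_imp_le)
    have "((\<lambda>r. r\<^sup>2 + \<delta>\<^sup>2) has_real_derivative 2 * r) (at r)"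
      by (auto intro!: derivative_eq_intros)
    from DERIV_chain2[OF DERIV_real_sqrt[OF D] this]
    have "((\<lambda>r. sqrt (r\<^sup>2 + \<delta>\<^sup>2)) has_real_derivative inverse ?q / 2 * (2 * r)) (at r)" .
    moreover have "inverse q / 2 * (2 * r) = r / q" for q by (simp add: inverse_eq_divide)
    ultimately have "((\<lambda>r. sqrt (r\<^sup>2 + \<delta>\<^sup>2)) has_real_derivative r / ?q) (at r)"
      by (simp only:)
    moreover have "?q \<noteq> 0" using q(1) by (rule less_imp_neq[symmetric])
    ultimately have "((\<lambda>r. r / sqrt (r\<^sup>2 + \<delta>\<^sup>2)) has_real_derivative
        (1 * ?q - r * (r / ?q)) / (?q * ?q)) (at r)"
      by (rule DERIV_divide[OF DERIV_ident])
    then have "((\<lambda>r. r / sqrt (r\<^sup>2 + \<delta>\<^sup>2)) has_real_derivative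
        (?q - r * (r / ?q)) / ?q\<^sup>2) (at r)"
      by (simp only: mult_1_left power2_eq_square)
    moreover have "(?q - r * (r / ?q)) / ?q\<^sup>2 = \<delta>\<^sup>2 / (?q\<^sup>2 * ?q)"
    proof -
      have "q - r * (r / q) = (q\<^sup>2 - r\<^sup>2) / q" if "q > 0" for q
        using that by (simp add: field_simps power2_eq_square)
      from this[OF q(1)] have "?q - r * (r / ?q) = \<delta>\<^sup>2 / ?q"
        by (simp only: q(2) add_diff_cancel_left')
      then show ?thesis by (simp only: divide_divide_eq_left mult.commute)
    qed
    ultimately show "((\<lambda>r. r / sqrt (r\<^sup>2 + \<delta>\<^sup>2)) has_real_derivative \<delta>\<^sup>2 / (?q\<^sup>2 * ?q))
        (at r within UNIV)" by simp
    have "\<delta>\<^sup>2 / (?q\<^sup>2 * ?q) = \<delta>\<^sup>2 / ?q\<^sup>2 * (1 / ?q)" by simp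
    also have "\<dots> \<le> 1 * (1 / \<bar>\<delta>\<bar>)"
    proof (intro mult_mono)
      show "\<delta>\<^sup>2 / ?q\<^sup>2 \<le> 1" unfolding q(2) using radicand_pos[OF False, of r] by simp
      have "\<bar>\<delta>\<bar> \<le> ?q" by (rule real_le_rsqrt) simp
      then show "1 / ?q \<le> 1 / \<bar>\<delta>\<bar>" using False by (simp add: frac_le)
    qed (use q in auto)
    finally show "norm (\<delta>\<^sup>2 / (?q\<^sup>2 * ?q)) \<le> 1 / \<bar>\<delta>\<bar>" using q(1) by simp
  qed auto
  moreover have "\<bar>slope \<delta> x - slope \<delta> y\<bar> \<le> \<bar>x / sqrt (x\<^sup>2 + \<delta>\<^sup>2) - y / sqrt (y\<^sup>2 + \<delta>\<^sup>2)\<bar>" for x y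
  proof -
    have "slope \<delta> r = \<bar>r / sqrt (r\<^sup>2 + \<delta>\<^sup>2)\<bar>" for r
      using False by (simp add: slope_def abs_divide)
    then show ?thesis by (simp only: abs_triangle_ineq3)
  qed
  ultimately have "dist (slope \<delta> x) (slope \<delta> y) \<le> 1 / \<bar>\<delta>\<bar> * dist x y" for x y
    unfolding dist_real_def real_norm_def by (meson order_trans)
  then have "(1 / \<bar>\<delta>\<bar>)-lipschitz_on UNIV (slope \<delta>)" by (intro lipschitz_onI) auto
  then show ?thesis by blast
qed

lemma bounded_lipschitz_slope_powr:
  assumes "p \<ge> 1"
  shows "bounded_lipschitz (\<lambda>r. slope \<delta> r powr p)"
proof -
  obtain L where "L-lipschitz_on UNIV (slope \<delta>)" using slope_lipschitz by blast
  then have "(p * L)-lipschitz_on UNIV (\<lambda>r. slope \<delta> r powr p)"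
    by (rule lipschitz_on_compose2)
      (rule lipschitz_on_subset[OF powr_lipschitz_on_unit_interval[OF assms]],
        use slope_bounds in auto)
  moreover have "\<bar>slope \<delta> r powr p\<bar> \<le> 1" for r
    using slope_bounds[of \<delta> r] assms by (simp add: powr_le1)
  ultimately show ?thesis unfolding bounded_lipschitz_def by blast
qed

lemma continuous_on_slope_powr:
  assumes "p \<ge> 1" "continuous_on I f"
  shows "continuous_on I (\<lambda>t. slope \<delta> (f t) powr p)"
proof -
  have "continuous_on UNIV (\<lambda>r. slope \<delta> r powr p)"
    using bounded_lipschitz_slope_powr[OF assms(1)] lipschitz_on_continuous_on
    unfolding bounded_lipschitz_def by blast
  from continuous_on_compose2[OF this assms(2)] show ?thesis by simp
qed

text \<open>With D = r^2 + \<delta>^2 the powers regroup as r^(\<alpha>/2+1) D^(-\<alpha>/4) = r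
  (r/sqrt D)^(\<alpha>/2) and r^(\<alpha>/2+2) D^(-(\<alpha>+4)/4) = (r/sqrt D)^(\<alpha>/2+2). For
  \<delta> \<noteq> 0 this persists at r = 0, where \<open>0 powr p = 0\<close> makes both sides
  vanish.\<close>

lemma reduced_field_eq_full_field:
  assumes "x \<in> phase_space"
  shows "reduced_field \<alpha> \<delta> x = full_field \<alpha> \<delta> x"
proof -
  obtain r v u where x: "x = (r, v, u)" "r \<ge> 0" using assms by (auto simp: phase_space_def)
  show ?thesis
  proof (cases "\<delta> = 0")
    case True
    then show ?thesis by (simp add: x reduced_field_def full_field_def slope_def)
  next
    case False
    let ?D = "r\<^sup>2 + \<delta>\<^sup>2"
    have D: "?D > 0" by (rule radicand_pos[OF False])
    have s: "slope \<delta> r powr p = r powr p * ?D powr (- p / 2)" for p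
    proof -
      have "?D powr (1 / 2) = sqrt ?D" using D by (intro powr_half_sqrt) linarith
      moreover have "\<bar>r\<bar> = r" using x(2) by (rule abs_of_nonneg)
      ultimately have "slope \<delta> r = r / ?D powr (1 / 2)"
        using False by (simp only: slope_def if_False)
      then have "slope \<delta> r powr p = r powr p / (?D powr (1 / 2)) powr p"
        by (simp only: powr_divide)
      also have "(?D powr (1 / 2)) powr p = ?D powr (p / 2)" unfolding powr_powr by simp
      finally show ?thesis
        by (simp only: powr_minus_divide minus_divide_left[symmetric] times_divide_eq_right mult_1_right)
    qed
    have e: "- (\<alpha> / 2) / 2 = - \<alpha> / 4" "- (\<alpha> / 2 + 2) / 2 = - (\<alpha> + 4) / 4"
      "(\<alpha> + 4) / 2 = \<alpha> / 2 + 2" "(\<alpha> + 2) / 2 = \<alpha> / 2 + 1" by (auto simp: field_simps)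
    have "r powr (\<alpha> / 2 + 1) = r * r powr (\<alpha> / 2)"
      using x(2) by (cases "r = 0") (auto simp: powr_add)
    moreover note s[of "\<alpha> / 2", unfolded e] s[of "\<alpha> / 2 + 2", unfolded e]
    ultimately show ?thesis using False
      by (simp add: x(1) reduced_field_def full_field_def e mult_ac)
  qed
qed

section \<open>Invariance of the energy surface\<close>

text \<open>Integrating factor: y exp(-A) is constant when A' = a. Positivity of the factor
  \<open>k\<close> is what carries both r > 0 and a vanishing energy defect along the curve.\<close>

lemma linear_ode_solution:
  fixes y a :: "real \<Rightarrow> real"
  assumes I: "is_interval I" "0 \<in> I" "t \<in> I" and a: "continuous_on I a"
    and y: "\<And>s. s \<in> I \<Longrightarrow> (y has_real_derivative a s * y s) (at s)"
  shows "\<exists>k>0. y t = y 0 * k"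
proof -
  \<comment> \<open>The coefficient is continuous on \<open>I\<close> only, so its antiderivative is
    taken on the compact segment between 0 and \<open>t\<close>.\<close>
  define J where "J = {min 0 t..max 0 t}"
  have J: "0 \<in> J" "t \<in> J" by (auto simp: J_def)
  have JI: "J \<subseteq> I"
  proof
    fix s assume "s \<in> J"
    then show "s \<in> I"
      using mem_is_interval_1_I[OF I, of s] mem_is_interval_1_I[OF I(1,3,2), of s]
      unfolding J_def by (cases "0 \<le> t") auto
  qed
  have "continuous_on {min 0 t..max 0 t} a"
    using continuous_on_subset[OF a JI] by (simp add: J_def)
  then obtain A where A: "\<And>s. s \<in> J \<Longrightarrow> (A has_vector_derivative a s) (at s within J)"
    unfolding J_def by (rule antiderivative_continuous) blast
  have "convex J" by (simp add: J_def)
  moreover have "((\<lambda>s. y s * exp (- A s)) has_real_derivative 0) (at s within J)" if "s \<in> J" for s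
  proof -
    have "(A has_real_derivative a s) (at s within J)"
      using A[OF that] by (simp add: has_real_derivative_iff_has_vector_derivative)
    moreover have "(y has_real_derivative a s * y s) (at s within J)"
      using y JI that has_field_derivative_at_within by blast
    ultimately show ?thesis
      by (auto intro!: derivative_eq_intros simp: algebra_simps)
  qed
  ultimately have "\<exists>c. \<forall>s\<in>J. y s * exp (- A s) = c"
    by (rule has_field_derivative_zero_constant)
  then have "y t * exp (- A t) = y 0 * exp (- A 0)" using J by force
  then have "y t * (exp (- A t) * exp (A t)) = y 0 * (exp (- A 0) * exp (A t))"
    by (simp only: mult.assoc[symmetric])
  then have "y t = y 0 * (exp (- A 0) * exp (A t))" by (simp flip: exp_add)
  then show ?thesis by (intro exI[of _ "exp (- A 0) * exp (A t)"]) auto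
qed

lemma has_vector_derivative_components:
  fixes \<phi> :: "real \<Rightarrow> state"
  assumes "(\<phi> has_vector_derivative (a, b, c)) (at t)"
  shows "((\<lambda>t. fst (\<phi> t)) has_real_derivative a) (at t)"
    and "((\<lambda>t. fst (snd (\<phi> t))) has_real_derivative b) (at t)"
    and "((\<lambda>t. snd (snd (\<phi> t))) has_real_derivative c) (at t)"
proof -
  note fst = bounded_linear.has_vector_derivative[OF bounded_linear_fst]
    and snd = bounded_linear.has_vector_derivative[OF bounded_linear_snd]
  show "((\<lambda>t. fst (\<phi> t)) has_real_derivative a) (at t)"
    "((\<lambda>t. fst (snd (\<phi> t))) has_real_derivative b) (at t)"
    "((\<lambda>t. snd (snd (\<phi> t))) has_real_derivative c) (at t)"
    using fst[OF assms] fst[OF snd[OF assms]] snd[OF snd[OF assms]]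
    by (simp_all add: has_real_derivative_iff_has_vector_derivative)
qed

lemma mem_energy_surface_pos:
  "(r, v, u) \<in> energy_surface_pos \<alpha> h \<delta> \<longleftrightarrow>
    r > 0 \<and> u\<^sup>2 + v\<^sup>2 = 2 * (1 - \<bar>h\<bar> * (r\<^sup>2 + \<delta>\<^sup>2) powr (\<alpha> / 2))"
  by (auto simp: energy_surface_pos_def energy_surface_def)

text \<open>Here \<open>P\<close> stands for \<rho>^\<alpha>, \<open>G\<close> for the speed factor
  shared by the v and u equations and \<open>C\<close> for an extra change of speed. The left side
  is the derivative of the energy defect, and the right side exhibits the defect as a
  factor.\<close>

lemma energy_rate_identity:
  fixes U V C G \<alpha> H P :: real
  shows "2 * U * (C * (G * ((\<alpha> - 2) / 2 * U * V))) + 2 * V * (C * (G * (U\<^sup>2 + \<alpha> / 2 * V\<^sup>2 - \<alpha>)))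
    + 2 * (H * (\<alpha> * C * G * V * P)) = \<alpha> * C * G * V * (U\<^sup>2 + V\<^sup>2 - 2 * (1 - H * P))"
proof -
  define a where "a = \<alpha> / 2"
  have a: "\<alpha> / 2 = a" "(\<alpha> - 2) / 2 = a - 1" "\<alpha> = 2 * a" by (simp_all add: a_def)
  show ?thesis unfolding a(1,2) unfolding a(3) by algebra
qed

text \<open>Along a solution, up to any continuous change of speed \<open>c\<close>, both \<open>r\<close> and the energy defect
  satisfy homogeneous linear equations.\<close>

lemma energy_surface_pos_invariant:
  fixes \<phi> :: "real \<Rightarrow> state" and c :: "real \<Rightarrow> real"
  assumes \<alpha>: "\<alpha> \<ge> 2" and I: "is_interval I" "0 \<in> I" "t \<in> I" and c: "continuous_on I c"
    and \<phi>: "\<And>s. s \<in> I \<Longrightarrow> (\<phi> has_vector_derivative c s *\<^sub>R full_field \<alpha> \<delta> (\<phi> s)) (at s)"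
    and \<phi>0: "\<phi> 0 \<in> energy_surface_pos \<alpha> h \<delta>"
  shows "\<phi> t \<in> energy_surface_pos \<alpha> h \<delta>"
proof -
  define r v u where "r s = fst (\<phi> s)" and "v s = fst (snd (\<phi> s))" and "u s = snd (snd (\<phi> s))" for s
  have \<phi>_eq: "\<phi> s = (r s, v s, u s)" for s by (simp add: r_def v_def u_def)
  define m g where "m s = slope \<delta> (r s) powr (\<alpha> / 2)" and "g s = slope \<delta> (r s) powr (\<alpha> / 2 + 2)" for s
  have deriv: "(r has_real_derivative c s * (r s * m s * v s)) (at s)"
    "(v has_real_derivative c s * (g s * ((u s)\<^sup>2 + \<alpha> / 2 * (v s)\<^sup>2 - \<alpha>))) (at s)"
    "(u has_real_derivative c s * (g s * ((\<alpha> - 2) / 2 * u s * v s))) (at s)" if "s \<in> I" for s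
    using has_vector_derivative_components[of \<phi> _ _ _ s] \<phi>[OF that]
    unfolding r_def[symmetric] v_def[symmetric] u_def[symmetric]
    by (auto simp: \<phi>_eq full_field_def m_def g_def)
  have cont: "continuous_on I r" "continuous_on I v" "continuous_on I u"
    using deriv by (meson DERIV_isCont continuous_at_imp_continuous_on)+
  have m_cont: "continuous_on I m" and g_cont: "continuous_on I g"
    unfolding m_def g_def using \<alpha> by (auto intro!: continuous_on_slope_powr cont)
  have start: "r 0 > 0" "(u 0)\<^sup>2 + (v 0)\<^sup>2 = 2 * (1 - \<bar>h\<bar> * ((r 0)\<^sup>2 + \<delta>\<^sup>2) powr (\<alpha> / 2))"
    using \<phi>0 by (simp_all add: \<phi>_eq mem_energy_surface_pos)
  have pos: "r s > 0" if "s \<in> I" for s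
  proof -
    have "\<exists>k>0. r s = r 0 * k"
    proof (rule linear_ode_solution[OF I(1,2) that])
      show "continuous_on I (\<lambda>s. c s * m s * v s)" by (intro continuous_intros c m_cont cont)
      show "(r has_real_derivative c s * m s * v s * r s) (at s)" if "s \<in> I" for s
        using deriv(1)[OF that] by (simp add: mult_ac)
    qed
    then show ?thesis using start by auto
  qed
  define D where "D s = (r s)\<^sup>2 + \<delta>\<^sup>2" for s
  define E where "E s = (u s)\<^sup>2 + (v s)\<^sup>2 - 2 * (1 - \<bar>h\<bar> * D s powr (\<alpha> / 2))" for s
  have defect_rate: "((\<lambda>s. (U s)\<^sup>2 + (V s)\<^sup>2 - 2 * (1 - H * Q s)) has_real_derivative
      2 * U s * U' + 2 * V s * V' + 2 * (H * Q')) (at s)"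
    if "(Q has_real_derivative Q') (at s)" "(V has_real_derivative V') (at s)"
      "(U has_real_derivative U') (at s)" for U V Q U' V' Q' H and s :: real
    using that by (auto intro!: derivative_eq_intros)
  have "\<exists>k>0. E t = E 0 * k"
  proof (rule linear_ode_solution[OF I])
    show "continuous_on I (\<lambda>s. \<alpha> * c s * g s * v s)" by (intro continuous_intros c g_cont cont)
    fix s assume s: "s \<in> I"
    have D: "D s > 0" using pos[OF s] by (simp add: D_def add_pos_nonneg)
    \<comment> \<open>This reconciles the two different powers of \<open>slope\<close> in the field:
      since slope times \<rho> is r, \<rho> obeys \<rho>' = \<rho> \<open>g\<close> v up to
      \<open>c\<close>, with the same factor \<open>g\<close> as the other two equations.\<close>
    have rm: "(r s)\<^sup>2 * m s = g s * D s"
    proof -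
      have "g s = m s * (slope \<delta> (r s))\<^sup>2"
        using slope_pos[of "r s" \<delta>] pos[OF s] by (simp add: g_def m_def powr_add)
      then show ?thesis using slope_sq[of "r s" \<delta>] pos[OF s] by (simp add: D_def mult_ac)
    qed
    have "(D has_real_derivative 2 * r s * (c s * (r s * m s * v s))) (at s)"
      unfolding D_def using deriv(1)[OF s] by (auto intro!: derivative_eq_intros)
    then have "((\<lambda>s. D s powr (\<alpha> / 2)) has_real_derivative
        \<alpha> / 2 * D s powr (\<alpha> / 2 - 1) * (2 * r s * (c s * (r s * m s * v s)))) (at s)"
      using D by (auto intro!: derivative_eq_intros)
    moreover have "\<alpha> / 2 * D s powr (\<alpha> / 2 - 1) * (2 * r s * (c s * (r s * m s * v s))) =
        \<alpha> * c s * g s * v s * D s powr (\<alpha> / 2)"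
    proof -
      have "2 * r s * (c s * (r s * m s * v s)) = 2 * c s * v s * ((r s)\<^sup>2 * m s)"
        by (simp add: power2_eq_square)
      then have "\<alpha> / 2 * D s powr (\<alpha> / 2 - 1) * (2 * r s * (c s * (r s * m s * v s))) =
          \<alpha> / 2 * D s powr (\<alpha> / 2 - 1) * (2 * c s * v s * (g s * D s))"
        by (simp only: rm)
      moreover have "D s powr (\<alpha> / 2) = D s powr (\<alpha> / 2 - 1) * D s"
        using D by (simp add: powr_diff)
      ultimately show ?thesis by simp
    qed
    ultimately have "((\<lambda>s. D s powr (\<alpha> / 2)) has_real_derivative
        \<alpha> * c s * g s * v s * D s powr (\<alpha> / 2)) (at s)" by (simp only:)
    then have "(E has_real_derivative
        2 * u s * (c s * (g s * ((\<alpha> - 2) / 2 * u s * v s)))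
        + 2 * v s * (c s * (g s * ((u s)\<^sup>2 + \<alpha> / 2 * (v s)\<^sup>2 - \<alpha>)))
        + 2 * (\<bar>h\<bar> * (\<alpha> * c s * g s * v s * D s powr (\<alpha> / 2)))) (at s)"
      unfolding E_def using deriv(2,3)[OF s] by (intro defect_rate)
    then show "(E has_real_derivative \<alpha> * c s * g s * v s * E s) (at s)"
      unfolding E_def energy_rate_identity .
  qed
  then have "E t = 0" using start by (auto simp: E_def D_def)
  then show ?thesis using pos[OF I(3)] by (simp add: \<phi>_eq mem_energy_surface_pos E_def D_def)
qed

section \<open>Boundedness of the surface, cutoff and the complete flow\<close>

lemma energy_surface_pos_bounded:
  assumes "\<alpha> > 0" "h \<noteq> 0"
  shows "bounded (energy_surface_pos \<alpha> h \<delta>)"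
proof -
  \<comment> \<open>Nonnegativity of u^2 + v^2 forces |h| \<rho>^\<alpha> \<le> 1, hence r \<le>
    |h|^(-1/\<alpha>); the 4 is the sum of the crude bounds |u| \<le> 2 and |v| \<le> 2.\<close>
  have "norm x \<le> \<bar>h\<bar> powr (- 1 / \<alpha>) + 4" if "x \<in> energy_surface_pos \<alpha> h \<delta>" for x
  proof -
    obtain r v u where x: "x = (r, v, u)" by (cases x)
    have r: "r > 0" and e: "u\<^sup>2 + v\<^sup>2 = 2 * (1 - \<bar>h\<bar> * (r\<^sup>2 + \<delta>\<^sup>2) powr (\<alpha> / 2))"
      using that by (auto simp: x mem_energy_surface_pos)
    have "u\<^sup>2 + v\<^sup>2 \<le> 2" unfolding e by simp
    then have "u\<^sup>2 \<le> 2\<^sup>2" "v\<^sup>2 \<le> 2\<^sup>2"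
      unfolding power2_eq_square[of 2] using zero_le_power2[of u] zero_le_power2[of v] by linarith+
    then have uv: "\<bar>u\<bar> \<le> 2" "\<bar>v\<bar> \<le> 2"
      using power2_le_iff_abs_le[of 2 u] power2_le_iff_abs_le[of 2 v] by auto
    have "\<bar>h\<bar> * (r\<^sup>2 + \<delta>\<^sup>2) powr (\<alpha> / 2) \<le> 1"
      using sum_power2_ge_zero[of u v] unfolding e by simp
    moreover have "(r\<^sup>2) powr (\<alpha> / 2) \<le> (r\<^sup>2 + \<delta>\<^sup>2) powr (\<alpha> / 2)"
      using assms by (intro powr_mono2) auto
    then have "\<bar>h\<bar> * (r\<^sup>2) powr (\<alpha> / 2) \<le> \<bar>h\<bar> * (r\<^sup>2 + \<delta>\<^sup>2) powr (\<alpha> / 2)"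
      by (rule mult_left_mono) simp
    moreover have "(r\<^sup>2) powr (\<alpha> / 2) = r powr \<alpha>"
      using r by (simp add: powr_powr flip: powr_numeral)
    then have "\<bar>h\<bar> * (r\<^sup>2) powr (\<alpha> / 2) = \<bar>h\<bar> * r powr \<alpha>" by simp
    ultimately have "\<bar>h\<bar> * r powr \<alpha> \<le> 1" by linarith
    then have "r powr \<alpha> \<le> 1 / \<bar>h\<bar>" using assms by (simp add: pos_le_divide_eq mult.commute)
    then have "(r powr \<alpha>) powr (1 / \<alpha>) \<le> (1 / \<bar>h\<bar>) powr (1 / \<alpha>)"
      using assms by (intro powr_mono2) auto
    moreover have "(r powr \<alpha>) powr (1 / \<alpha>) = r" using assms r by (simp add: powr_powr)
    moreover have "(1 / \<bar>h\<bar>) powr (1 / \<alpha>) = \<bar>h\<bar> powr (- 1 / \<alpha>)"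
      by (simp only: powr_divide powr_one_eq_one minus_divide_left[symmetric] powr_minus_divide)
    ultimately have "r \<le> \<bar>h\<bar> powr (- 1 / \<alpha>)" by simp
    moreover have "norm x \<le> \<bar>r\<bar> + (\<bar>v\<bar> + \<bar>u\<bar>)"
      unfolding x by (metis add_left_mono norm_Pair_le order_trans real_norm_def)
    ultimately show ?thesis using uv r by linarith
  qed
  then show ?thesis unfolding bounded_iff by blast
qed

text \<open>The cutoff alone would leave unbounded factors, so every coordinate is also clamped to
  [-(B+1), B+1]. Where the cutoff is nonzero the clamps act as the identity, so the product is still
  exactly a scalar multiple of the field.\<close>

lemma lipschitz_cutoff_exists:
  assumes \<alpha>: "\<alpha> \<ge> 2" and S: "bounded S"
  obtains G L \<kappa> where "L-lipschitz_on UNIV G" "continuous_on UNIV \<kappa>"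
    "\<And>x. G x = \<kappa> x *\<^sub>R full_field \<alpha> \<delta> x" "\<And>x. x \<in> S \<Longrightarrow> \<kappa> x = 1"
proof -
  obtain B where B: "\<And>x. x \<in> S \<Longrightarrow> norm x \<le> B" using S by (auto simp: bounded_iff)
  define \<kappa> :: "state \<Rightarrow> real" where "\<kappa> x = max 0 (min 1 (B + 1 - norm x))" for x
  define cl :: "real \<Rightarrow> real" where "cl z = max (- (B + 1)) (min (B + 1) z)" for z
  define r v u :: "state \<Rightarrow> real" where "r = fst" and "v x = fst (snd x)" and "u x = snd (snd x)" for x
  have lip: "1-lipschitz_on UNIV r" "(1 * 1)-lipschitz_on UNIV v" "(1 * 1)-lipschitz_on UNIV u"
    unfolding r_def v_def u_def
    by (rule lipschitz_on_fst lipschitz_on_compose2[OF lipschitz_on_snd]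
        lipschitz_on_subset[OF lipschitz_on_fst] lipschitz_on_subset[OF lipschitz_on_snd] | simp)+
  have bcl: "bounded_lipschitz cl" unfolding cl_def by (rule bounded_lipschitz_clamp)
  have b\<kappa>: "bounded_lipschitz \<kappa>"
    unfolding \<kappa>_def
  proof (rule bounded_lipschitz_compose[OF bounded_lipschitz_clamp])
    show "1-lipschitz_on UNIV (\<lambda>x::state. B + 1 - norm x)"
    proof (rule lipschitz_onI)
      fix x y :: state
      show "dist (B + 1 - norm x) (B + 1 - norm y) \<le> 1 * dist x y"
        using norm_triangle_ineq3[of x y] by (simp add: dist_norm dist_real_def abs_minus_commute)
    qed simp
  qed
  define G where "G x =
    (\<kappa> x * (cl (r x) * slope \<delta> (r x) powr (\<alpha> / 2) * cl (v x)),
     \<kappa> x * (slope \<delta> (r x) powr (\<alpha> / 2 + 2) * ((cl (u x))\<^sup>2 + \<alpha> / 2 * (cl (v x))\<^sup>2 - \<alpha>)),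
     \<kappa> x * (slope \<delta> (r x) powr (\<alpha> / 2 + 2) * ((\<alpha> - 2) / 2 * cl (u x) * cl (v x))))" for x
  have lip_ex: "\<exists>L. L-lipschitz_on UNIV f" if "bounded_lipschitz f" for f :: "state \<Rightarrow> real"
    using that by (simp add: bounded_lipschitz_def)
  have "\<exists>L. L-lipschitz_on UNIV G"
    unfolding G_def using \<alpha>
    by (intro bounded_lipschitz_Pair lip_ex bounded_lipschitz_mult bounded_lipschitz_add
        bounded_lipschitz_diff bounded_lipschitz_power2 bounded_lipschitz_const b\<kappa>
        bounded_lipschitz_compose[OF bcl lip(1)] bounded_lipschitz_compose[OF bcl lip(2)]
        bounded_lipschitz_compose[OF bcl lip(3)]
        bounded_lipschitz_compose[OF bounded_lipschitz_slope_powr lip(1)]) simp_all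
  then obtain L where "L-lipschitz_on UNIV G" by blast
  moreover have "continuous_on UNIV \<kappa>" unfolding \<kappa>_def by (intro continuous_intros)
  moreover have "G x = \<kappa> x *\<^sub>R full_field \<alpha> \<delta> x" for x
  proof (cases "norm x < B + 1")
    case True
    have "\<bar>r x\<bar> \<le> norm x" "\<bar>v x\<bar> \<le> norm x" "\<bar>u x\<bar> \<le> norm x"
      unfolding r_def v_def u_def
      by (metis norm_fst_le norm_snd_le order_trans real_norm_def prod.collapse)+
    then have "cl (r x) = r x" "cl (v x) = v x" "cl (u x) = u x"
      using True by (auto simp: cl_def max_def min_def)
    then show ?thesis by (simp add: G_def full_field_def r_def v_def u_def split_beta)
  next
    case False
    then have "\<kappa> x = 0" by (simp add: \<kappa>_def)
    then show ?thesis by (simp add: G_def zero_prod_def)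
  qed
  moreover have "\<kappa> x = 1" if "x \<in> S" for x using B[OF that] by (simp add: \<kappa>_def)
  ultimately show ?thesis by (rule that)
qed

text \<open>The invariance result is used with two speeds: the cutoff along the curve, for solutions
  of the Lipschitz field, and the constant 1, for arbitrary competing curves of the reduced field in
  the phase space.\<close>

lemma reduced_field_generates_flow:
  assumes \<alpha>: "\<alpha> \<ge> 2" and h: "h \<noteq> 0"
  shows "generates_flow_on (reduced_field \<alpha> \<delta>) phase_space (energy_surface_pos \<alpha> h \<delta>)"
proof -
  let ?S = "energy_surface_pos \<alpha> h \<delta>"
  have sub: "?S \<subseteq> phase_space" by (auto simp: mem_energy_surface_pos phase_space_def)
  have "bounded ?S" using \<alpha> h by (intro energy_surface_pos_bounded) auto
  then obtain G L \<kappa> where L: "L-lipschitz_on UNIV G" and \<kappa>: "continuous_on UNIV \<kappa>"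
    and G: "\<And>x. G x = \<kappa> x *\<^sub>R full_field \<alpha> \<delta> x" and \<kappa>1: "\<And>x. x \<in> ?S \<Longrightarrow> \<kappa> x = 1"
    using lipschitz_cutoff_exists[OF \<alpha>, of ?S] by metis
  show ?thesis
  proof (rule generates_flow_onI[OF L sub])
    show "G x = reduced_field \<alpha> \<delta> x" if "x \<in> ?S" for x
      using that sub by (auto simp: G \<kappa>1 reduced_field_eq_full_field)
    show "x t \<in> ?S" if "x 0 \<in> ?S" "\<And>t. (x has_vector_derivative G (x t)) (at t)" for x t
    proof (rule energy_surface_pos_invariant[where I = UNIV and c = "\<lambda>s. \<kappa> (x s)"])
      have "continuous_on UNIV x"
        using that(2) by (meson continuous_at_imp_continuous_on has_vector_derivative_continuous)
      then show "continuous_on UNIV (\<lambda>s. \<kappa> (x s))" by (rule continuous_on_compose2[OF \<kappa>]) simp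
      show "(x has_vector_derivative \<kappa> (x s) *\<^sub>R full_field \<alpha> \<delta> (x s)) (at s)" for s
        using that(2)[of s] by (simp add: G)
    qed (use \<alpha> that(1) in auto)
    show "\<phi> t \<in> ?S" if \<phi>: "integral_curve (reduced_field \<alpha> \<delta>) phase_space I \<phi>" "\<phi> 0 \<in> ?S" "t \<in> I" for I \<phi> t
    proof (rule energy_surface_pos_invariant[where I = I and c = "\<lambda>s. 1"])
      show "continuous_on I (\<lambda>s. 1 :: real)" by (rule continuous_on_const)
      show "(\<phi> has_vector_derivative 1 *\<^sub>R full_field \<alpha> \<delta> (\<phi> s)) (at s)" if "s \<in> I" for s
        using \<phi>(1) that by (auto simp: integral_curve_def reduced_field_eq_full_field)
    qed (use \<alpha> \<phi> in \<open>auto simp: integral_curve_def\<close>)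
  qed
qed

section \<open>Solutions on the energy surface\<close>

text \<open>Phrased with \<open>full_field\<close>, whose single formula in terms of
  \<open>slope\<close> covers zero and nonzero \<delta> alike.\<close>

definition energy_solution :: "real \<Rightarrow> real \<Rightarrow> real \<Rightarrow> (real \<Rightarrow> state) \<Rightarrow> bool" where
  "energy_solution \<alpha> h \<delta> \<phi> \<longleftrightarrow> (\<forall>t. \<phi> t \<in> energy_surface_pos \<alpha> h \<delta> \<and>
     (\<phi> has_vector_derivative full_field \<alpha> \<delta> (\<phi> t)) (at t))"

lemma energy_solution_components:
  assumes "energy_solution \<alpha> h \<delta> \<phi>"
  obtains r v u where "\<And>t. \<phi> t = (r t, v t, u t)" "\<And>t. r t > 0"
    "\<And>t. (u t)\<^sup>2 + (v t)\<^sup>2 = 2 * (1 - \<bar>h\<bar> * ((r t)\<^sup>2 + \<delta>\<^sup>2) powr (\<alpha> / 2))"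
    "\<And>t. (r has_real_derivative r t * slope \<delta> (r t) powr (\<alpha> / 2) * v t) (at t)"
    "\<And>t. (v has_real_derivative
       slope \<delta> (r t) powr (\<alpha> / 2 + 2) * ((u t)\<^sup>2 + \<alpha> / 2 * (v t)\<^sup>2 - \<alpha>)) (at t)"
    "\<And>t. (u has_real_derivative
       slope \<delta> (r t) powr (\<alpha> / 2 + 2) * ((\<alpha> - 2) / 2 * u t * v t)) (at t)"
proof -
  define r v u where "r s = fst (\<phi> s)" and "v s = fst (snd (\<phi> s))" and "u s = snd (snd (\<phi> s))" for s
  have \<phi>_eq: "\<phi> s = (r s, v s, u s)" for s by (simp add: r_def v_def u_def)
  have S: "(r t, v t, u t) \<in> energy_surface_pos \<alpha> h \<delta>"
    and d: "(\<phi> has_vector_derivative full_field \<alpha> \<delta> (r t, v t, u t)) (at t)" for t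
    using assms unfolding energy_solution_def by (metis \<phi>_eq)+
  note deriv = has_vector_derivative_components[OF d[unfolded full_field_def split_conv],
      folded r_def v_def u_def]
  show ?thesis
    using S by (intro that[of r v u] \<phi>_eq deriv) (auto simp: mem_energy_surface_pos)
qed

text \<open>Reversibility: r' and u' are odd in v, while v' and the energy relation are even in
  v.\<close>

lemma energy_solution_reverse:
  assumes "energy_solution \<alpha> h \<delta> \<phi>"
  shows "energy_solution \<alpha> h \<delta> (\<lambda>t. (fst (\<phi> (- t)), - fst (snd (\<phi> (- t))), snd (snd (\<phi> (- t)))))"
proof -
  obtain r v u where \<phi>: "\<And>t. \<phi> t = (r t, v t, u t)" and pos: "\<And>t. r t > 0"
    and e: "\<And>t. (u t)\<^sup>2 + (v t)\<^sup>2 = 2 * (1 - \<bar>h\<bar> * ((r t)\<^sup>2 + \<delta>\<^sup>2) powr (\<alpha> / 2))"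
    and r: "\<And>t. (r has_real_derivative r t * slope \<delta> (r t) powr (\<alpha> / 2) * v t) (at t)"
    and v: "\<And>t. (v has_real_derivative
       slope \<delta> (r t) powr (\<alpha> / 2 + 2) * ((u t)\<^sup>2 + \<alpha> / 2 * (v t)\<^sup>2 - \<alpha>)) (at t)"
    and u: "\<And>t. (u has_real_derivative
       slope \<delta> (r t) powr (\<alpha> / 2 + 2) * ((\<alpha> - 2) / 2 * u t * v t)) (at t)"
    using energy_solution_components[OF assms] by metis
  have rev: "((\<lambda>t. f (- t)) has_vector_derivative - f') (at t)"
    if "(f has_real_derivative f') (at (- t))" for f :: "real \<Rightarrow> real" and f' t
    using that by (intro has_vector_derivative_reflect)
      (simp add: has_real_derivative_iff_has_vector_derivative)
  have "((\<lambda>t. (r (- t), - v (- t), u (- t))) has_vector_derivative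
      full_field \<alpha> \<delta> (r (- t), - v (- t), u (- t))) (at t)" for t
    using has_vector_derivative_Pair[OF rev[OF r] has_vector_derivative_Pair[OF
        has_vector_derivative_minus[OF rev[OF v]] rev[OF u]], of t]
    by (simp add: full_field_def)
  then show ?thesis
    unfolding energy_solution_def using pos e by (simp add: \<phi> mem_energy_surface_pos)
qed

section \<open>Monotonicity of v and collision at both ends of every orbit\<close>

lemma v_rate_le:
  fixes r v u :: real
  assumes \<alpha>: "\<alpha> \<ge> 2" and e: "u\<^sup>2 + v\<^sup>2 = 2 * (1 - \<bar>h\<bar> * (r\<^sup>2 + \<delta>\<^sup>2) powr (\<alpha> / 2))"
  shows "u\<^sup>2 + \<alpha> / 2 * v\<^sup>2 - \<alpha> \<le> - 2 * (\<bar>h\<bar> * (r\<^sup>2 + \<delta>\<^sup>2) powr (\<alpha> / 2))" and "\<bar>v\<bar> \<le> 2"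
proof -
  define X where "X = \<bar>h\<bar> * (r\<^sup>2 + \<delta>\<^sup>2) powr (\<alpha> / 2)"
  have "X \<ge> 0" by (simp add: X_def)
  have e': "u\<^sup>2 = 2 - 2 * X - v\<^sup>2" using e by (simp add: X_def)
  then have v: "v\<^sup>2 \<le> 2" using \<open>X \<ge> 0\<close> zero_le_power2[of u] by linarith
  \<comment> \<open>Eliminating u^2 by the energy relation isolates a term whose sign is settled by
    \<alpha> \<ge> 2 and v^2 \<le> 2.\<close>
  have "u\<^sup>2 + \<alpha> / 2 * v\<^sup>2 - \<alpha> = - 2 * X - (\<alpha> / 2 - 1) * (2 - v\<^sup>2)"
    unfolding e' by (simp add: algebra_simps)
  also have "\<dots> \<le> - 2 * X" using \<alpha> v by (simp add: mult_nonneg_nonneg)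
  finally show "u\<^sup>2 + \<alpha> / 2 * v\<^sup>2 - \<alpha> \<le> - 2 * (\<bar>h\<bar> * (r\<^sup>2 + \<delta>\<^sup>2) powr (\<alpha> / 2))"
    by (simp add: X_def)
  have "\<bar>v\<bar>\<^sup>2 \<le> 2\<^sup>2" using v by simp
  then show "\<bar>v\<bar> \<le> 2" by (rule power2_le_imp_le) simp
qed

lemma energy_solution_v_decreasing:
  assumes \<alpha>: "\<alpha> \<ge> 2" and h: "h \<noteq> 0" and \<phi>: "energy_solution \<alpha> h \<delta> \<phi>" and "s < t"
  shows "fst (snd (\<phi> t)) < fst (snd (\<phi> s))"
proof -
  obtain r v u where \<phi>_eq: "\<And>t. \<phi> t = (r t, v t, u t)" and pos: "\<And>t. r t > 0"
    and e: "\<And>t. (u t)\<^sup>2 + (v t)\<^sup>2 = 2 * (1 - \<bar>h\<bar> * ((r t)\<^sup>2 + \<delta>\<^sup>2) powr (\<alpha> / 2))"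
    and v: "\<And>t. (v has_real_derivative
       slope \<delta> (r t) powr (\<alpha> / 2 + 2) * ((u t)\<^sup>2 + \<alpha> / 2 * (v t)\<^sup>2 - \<alpha>)) (at t)"
    using energy_solution_components[OF \<phi>] by metis
  have "v t < v s"
  proof (rule DERIV_neg_imp_decreasing[OF \<open>s < t\<close>])
    fix x
    have "(r x)\<^sup>2 + \<delta>\<^sup>2 > 0" using pos[of x] by (simp add: add_pos_nonneg)
    then have "0 < ((r x)\<^sup>2 + \<delta>\<^sup>2) powr (\<alpha> / 2)" unfolding powr_gt_zero by linarith
    then have "0 < \<bar>h\<bar> * ((r x)\<^sup>2 + \<delta>\<^sup>2) powr (\<alpha> / 2)" using h by (intro mult_pos_pos) auto
    with v_rate_le(1)[OF \<alpha> e] have "(u x)\<^sup>2 + \<alpha> / 2 * (v x)\<^sup>2 - \<alpha> < 0"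
      by (smt (verit))
    moreover have "0 < slope \<delta> (r x) powr (\<alpha> / 2 + 2)"
      using slope_pos[of "r x" \<delta>] pos[of x] by simp
    ultimately show "\<exists>y. (v has_real_derivative y) (at x) \<and> y < 0"
      using v[of x] by (meson mult_pos_neg)
  qed
  then show ?thesis by (simp add: \<phi>_eq)
qed

text \<open>While \<open>r \<ge> l\<close>, the bounded quantity \<open>v\<close> decreases at a rate bounded away from zero.\<close>

lemma energy_solution_r_small:
  assumes \<alpha>: "\<alpha> \<ge> 2" and h: "h \<noteq> 0" and \<phi>: "energy_solution \<alpha> h \<delta> \<phi>" and l: "l > 0"
  shows "\<exists>t\<ge>t0. fst (\<phi> t) < l"
proof (rule ccontr)
  assume contra: "\<not> (\<exists>t\<ge>t0. fst (\<phi> t) < l)"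
  obtain r v u where \<phi>_eq: "\<And>t. \<phi> t = (r t, v t, u t)" and pos: "\<And>t. r t > 0"
    and e: "\<And>t. (u t)\<^sup>2 + (v t)\<^sup>2 = 2 * (1 - \<bar>h\<bar> * ((r t)\<^sup>2 + \<delta>\<^sup>2) powr (\<alpha> / 2))"
    and v: "\<And>t. (v has_real_derivative
       slope \<delta> (r t) powr (\<alpha> / 2 + 2) * ((u t)\<^sup>2 + \<alpha> / 2 * (v t)\<^sup>2 - \<alpha>)) (at t)"
    using energy_solution_components[OF \<phi>] by metis
  have ge: "r t \<ge> l" if "t \<ge> t0" for t using contra that by (force simp: \<phi>_eq)
  \<comment> \<open>A lower bound for the descent rate at r = l with \<delta>^2 dropped from the
    potential term; both factors are nondecreasing in r, so it is valid for all r \<ge> l.\<close>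
  define c where "c = slope \<delta> l powr (\<alpha> / 2 + 2) * (2 * (\<bar>h\<bar> * (l\<^sup>2) powr (\<alpha> / 2)))"
  have c: "c > 0" using h l slope_pos[of l \<delta>] by (simp add: c_def)
  have rate: "slope \<delta> (r t) powr (\<alpha> / 2 + 2) * ((u t)\<^sup>2 + \<alpha> / 2 * (v t)\<^sup>2 - \<alpha>) \<le> - c"
    if "t \<ge> t0" for t
  proof -
    have "l\<^sup>2 \<le> (r t)\<^sup>2" using ge[OF that] l by (intro power_mono) auto
    then have "l\<^sup>2 \<le> (r t)\<^sup>2 + \<delta>\<^sup>2" using zero_le_power2[of \<delta>] by linarith
    then have "(l\<^sup>2) powr (\<alpha> / 2) \<le> ((r t)\<^sup>2 + \<delta>\<^sup>2) powr (\<alpha> / 2)"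
      using \<alpha> by (intro powr_mono2) auto
    then have *: "2 * (\<bar>h\<bar> * (l\<^sup>2) powr (\<alpha> / 2)) \<le> 2 * (\<bar>h\<bar> * ((r t)\<^sup>2 + \<delta>\<^sup>2) powr (\<alpha> / 2))"
      by (intro mult_left_mono) auto
    have "slope \<delta> l powr (\<alpha> / 2 + 2) \<le> slope \<delta> (r t) powr (\<alpha> / 2 + 2)"
      using slope_mono[OF l ge[OF that]] slope_bounds \<alpha> by (intro powr_mono2) auto
    then have "c \<le> slope \<delta> (r t) powr (\<alpha> / 2 + 2) * (2 * (\<bar>h\<bar> * ((r t)\<^sup>2 + \<delta>\<^sup>2) powr (\<alpha> / 2)))"
      unfolding c_def by (rule mult_mono[OF _ *]) auto
    also have "\<dots> \<le> slope \<delta> (r t) powr (\<alpha> / 2 + 2) * - ((u t)\<^sup>2 + \<alpha> / 2 * (v t)\<^sup>2 - \<alpha>)"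
      using v_rate_le(1)[OF \<alpha> e[of t]] by (intro mult_left_mono) auto
    finally show ?thesis unfolding mult_minus_right by linarith
  qed
  \<comment> \<open>Descending at rate at least \<open>c\<close> from time \<open>t0\<close>, v is
    at most -3 at time \<open>T\<close>, below its lower bound -2.\<close>
  define T where "T = t0 + (v t0 + 3) / c"
  have bound: "- 2 \<le> v t" for t using v_rate_le(2)[OF \<alpha> e[of t]] by linarith
  have T: "t0 \<le> T" using bound[of t0] c by (simp add: T_def)
  have "v T + c * T \<le> v t0 + c * t0"
  proof (rule DERIV_nonpos_imp_nonincreasing[OF T])
    fix x assume "t0 \<le> x"
    then show "\<exists>y. ((\<lambda>t. v t + c * t) has_real_derivative y) (at x) \<and> y \<le> 0"
      using rate[of x] v[of x]
      by (intro exI[of _ "slope \<delta> (r x) powr (\<alpha> / 2 + 2) * ((u x)\<^sup>2 + \<alpha> / 2 * (v x)\<^sup>2 - \<alpha>) + c"])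
        (auto intro!: derivative_eq_intros)
  qed
  moreover have "c * T = c * t0 + v t0 + 3" using c by (simp add: T_def field_simps)
  ultimately show False using bound[of T] by linarith
qed

text \<open>That r gets below every level does not yet give a limit. It does rule out v \<ge> 0 for
  all time, since r would then be nondecreasing; and once v is negative it stays so, r is
  nonincreasing, and each level passed is passed for good.\<close>

lemma energy_solution_falls:
  assumes \<alpha>: "\<alpha> \<ge> 2" and h: "h \<noteq> 0" and \<phi>: "energy_solution \<alpha> h \<delta> \<phi>"
  shows "\<exists>t. fst (snd (\<phi> t)) < 0" and "((\<lambda>t. fst (\<phi> t)) \<longlongrightarrow> 0) at_top"
proof -
  obtain r v u where \<phi>_eq: "\<And>t. \<phi> t = (r t, v t, u t)" and pos: "\<And>t. r t > 0"
    and r: "\<And>t. (r has_real_derivative r t * slope \<delta> (r t) powr (\<alpha> / 2) * v t) (at t)"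
    using energy_solution_components[OF \<phi>] by metis
  have small: "\<exists>t\<ge>t0. r t < l" if "l > 0" for l t0
    using energy_solution_r_small[OF \<alpha> h \<phi> that] by (simp add: \<phi>_eq)
  have "\<exists>t. v t < 0"
  proof (rule ccontr)
    assume "\<not> (\<exists>t. v t < 0)"
    then have v: "v t \<ge> 0" for t by (simp add: not_less)
    obtain t where t: "t \<ge> 0" "r t < r 0" using small[OF pos, of 0 0] by blast
    have "r 0 \<le> r t"
    proof (rule DERIV_nonneg_imp_nondecreasing[OF t(1)])
      fix x
      have "0 \<le> r x * slope \<delta> (r x) powr (\<alpha> / 2) * v x" using pos[of x] v[of x] by simp
      then show "\<exists>y. (r has_real_derivative y) (at x) \<and> 0 \<le> y" using r by blast
    qed
    then show False using t by simp
  qed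
  then obtain t0 where t0: "v t0 < 0" by blast
  then show "\<exists>t. fst (snd (\<phi> t)) < 0" by (auto simp: \<phi>_eq)
  have neg: "v t \<le> 0" if "t \<ge> t0" for t
    using energy_solution_v_decreasing[OF \<alpha> h \<phi>, of t0 t] that t0
    by (cases "t = t0") (auto simp: \<phi>_eq)
  have mono: "r t \<le> r s" if "t0 \<le> s" "s \<le> t" for s t
  proof (rule DERIV_nonpos_imp_nonincreasing[OF that(2)])
    fix x assume "s \<le> x"
    then have "r x * slope \<delta> (r x) powr (\<alpha> / 2) * v x \<le> 0"
      using pos[of x] neg[of x] that(1) by (intro mult_nonneg_nonpos) auto
    then show "\<exists>y. (r has_real_derivative y) (at x) \<and> y \<le> 0" using r by blast
  qed
  have "(r \<longlongrightarrow> 0) at_top"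
  proof (rule order_tendstoI)
    show "\<forall>\<^sub>F t in at_top. a < r t" if "a < 0" for a
      using pos that by (intro always_eventually) (meson less_trans)
    fix a :: real assume "0 < a"
    then obtain s where s: "s \<ge> t0" "r s < a" using small by blast
    show "\<forall>\<^sub>F t in at_top. r t < a"
      using eventually_ge_at_top[of s] by eventually_elim (use mono s in fastforce)
  qed
  then show "((\<lambda>t. fst (\<phi> t)) \<longlongrightarrow> 0) at_top" by (simp add: \<phi>_eq)
qed

lemma energy_solution_ejects:
  assumes \<alpha>: "\<alpha> \<ge> 2" and h: "h \<noteq> 0" and \<phi>: "energy_solution \<alpha> h \<delta> \<phi>"
  shows "\<exists>t. fst (snd (\<phi> t)) > 0" and "((\<lambda>t. fst (\<phi> t)) \<longlongrightarrow> 0) at_bot"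
proof -
  note rev = energy_solution_falls[OF \<alpha> h energy_solution_reverse[OF \<phi>]]
  show "\<exists>t. fst (snd (\<phi> t)) > 0" using rev(1) by auto
  show "((\<lambda>t. fst (\<phi> t)) \<longlongrightarrow> 0) at_bot"
    using rev(2) by (simp add: filterlim_at_bot_mirror)
qed

lemma energy_solution_v_zero:
  assumes \<alpha>: "\<alpha> \<ge> 2" and h: "h \<noteq> 0" and \<phi>: "energy_solution \<alpha> h \<delta> \<phi>"
  shows "\<exists>t. fst (snd (\<phi> t)) = 0"
proof -
  obtain a b where ab: "fst (snd (\<phi> a)) > 0" "fst (snd (\<phi> b)) < 0"
    using energy_solution_falls(1)[OF assms] energy_solution_ejects(1)[OF assms] by blast
  have "continuous_on UNIV \<phi>"
    using \<phi> unfolding energy_solution_def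
    by (meson continuous_at_imp_continuous_on has_vector_derivative_continuous)
  then have "continuous_on A (\<lambda>t. fst (snd (\<phi> t)))" for A
    by (intro continuous_intros) (auto intro: continuous_on_subset)
  moreover have "a < b"
    using energy_solution_v_decreasing[OF assms, of b a] ab by (cases a b rule: linorder_cases) auto
  ultimately show ?thesis
    using IVT2'[of "\<lambda>t. fst (snd (\<phi> t))" b 0 a] ab by force
qed

text \<open>On the section \<open>v = 0\<close> the energy relation determines \<open>r\<close> from \<open>u\<close>.\<close>

lemma section_homeomorphic_interval:
  assumes \<alpha>: "\<alpha> > 0" and h: "h \<noteq> 0" and c: "c = sqrt (2 * (1 - \<bar>h\<bar> * (\<delta>\<^sup>2) powr (\<alpha> / 2)))"
  shows "{x \<in> energy_surface_pos \<alpha> h \<delta>. fst (snd x) = 0} homeomorphic {- c<..<c}"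
proof -
  \<comment> \<open>\<open>k u\<close> is the value of \<rho>^\<alpha> that the energy relation
    prescribes when v = 0, and \<open>f\<close> recovers r from r^2 = \<rho>^2 - \<delta>^2. The
    endpoint \<open>c\<close> is where \<rho> = |\<delta>|, so |u| < c expresses r > 0.\<close>
  define k where "k u = (1 - u\<^sup>2 / 2) / \<bar>h\<bar>" for u :: real
  define f where "f u = (sqrt (k u powr (2 / \<alpha>) - \<delta>\<^sup>2), 0 :: real, u)" for u
  have f: "f u \<in> energy_surface_pos \<alpha> h \<delta>" and k: "k u > 0" if "u \<in> {- c<..<c}" for u
  proof -
    have "\<bar>u\<bar> < c" using that by auto
    then have "u\<^sup>2 < c\<^sup>2" by (metis abs_ge_zero power2_abs power_strict_mono pos2)
    moreover have "c > 0" using \<open>\<bar>u\<bar> < c\<close> by linarith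
    then have "c\<^sup>2 = 2 * (1 - \<bar>h\<bar> * (\<delta>\<^sup>2) powr (\<alpha> / 2))" unfolding c by simp
    ultimately have "\<bar>h\<bar> * (\<delta>\<^sup>2) powr (\<alpha> / 2) < 1 - u\<^sup>2 / 2" by simp
    then have k_gt: "(\<delta>\<^sup>2) powr (\<alpha> / 2) < k u"
      using h by (simp add: k_def pos_less_divide_eq mult.commute)
    then show "k u > 0" by (meson order_le_less_trans powr_ge_zero)
    have "((\<delta>\<^sup>2) powr (\<alpha> / 2)) powr (2 / \<alpha>) < k u powr (2 / \<alpha>)"
      using k_gt \<alpha> by (intro powr_less_mono2) auto
    moreover have "((\<delta>\<^sup>2) powr (\<alpha> / 2)) powr (2 / \<alpha>) = \<delta>\<^sup>2"
      using \<alpha> by (simp add: powr_powr)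
    ultimately have gt: "\<delta>\<^sup>2 < k u powr (2 / \<alpha>)" by simp
    have "(k u powr (2 / \<alpha>)) powr (\<alpha> / 2) = k u"
      using \<open>k u > 0\<close> \<alpha> by (simp add: powr_powr)
    moreover have "\<bar>h\<bar> * k u = 1 - u\<^sup>2 / 2" using h by (simp add: k_def)
    ultimately show "f u \<in> energy_surface_pos \<alpha> h \<delta>"
      using gt by (simp add: f_def mem_energy_surface_pos)
  qed
  have inv: "snd (snd x) \<in> {- c<..<c} \<and> f (snd (snd x)) = x"
    if "x \<in> energy_surface_pos \<alpha> h \<delta>" "fst (snd x) = 0" for x
  proof -
    from that(2) obtain r u where x: "x = (r, 0, u)" by (cases x) auto
    have r: "r > 0" and e: "u\<^sup>2 = 2 * (1 - \<bar>h\<bar> * (r\<^sup>2 + \<delta>\<^sup>2) powr (\<alpha> / 2))"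
      using that(1) by (auto simp: x mem_energy_surface_pos)
    have "(\<delta>\<^sup>2) powr (\<alpha> / 2) < (r\<^sup>2 + \<delta>\<^sup>2) powr (\<alpha> / 2)"
      using r \<alpha> by (intro powr_less_mono2) auto
    then have "\<bar>h\<bar> * (\<delta>\<^sup>2) powr (\<alpha> / 2) < \<bar>h\<bar> * (r\<^sup>2 + \<delta>\<^sup>2) powr (\<alpha> / 2)"
      using h by (intro mult_strict_left_mono) auto
    then have "u\<^sup>2 < 2 * (1 - \<bar>h\<bar> * (\<delta>\<^sup>2) powr (\<alpha> / 2))" unfolding e by simp
    then have "sqrt (u\<^sup>2) < c" unfolding c by (rule real_sqrt_less_mono)
    then have "\<bar>u\<bar> < c" by simp
    moreover have "1 - u\<^sup>2 / 2 = \<bar>h\<bar> * (r\<^sup>2 + \<delta>\<^sup>2) powr (\<alpha> / 2)" using e by argo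
    then have "k u = (r\<^sup>2 + \<delta>\<^sup>2) powr (\<alpha> / 2)" using h by (simp add: k_def)
    then have "k u powr (2 / \<alpha>) = r\<^sup>2 + \<delta>\<^sup>2" using \<alpha> by (simp add: powr_powr)
    ultimately show ?thesis using r by (auto simp: x f_def)
  qed
  have "continuous_on {- c<..<c} f"
    unfolding f_def k_def using k h
    by (intro continuous_intros) (force simp: k_def)+
  then have "homeomorphism {x \<in> energy_surface_pos \<alpha> h \<delta>. fst (snd x) = 0} {- c<..<c} (\<lambda>x. snd (snd x)) f"
    using inv f by (intro homeomorphismI continuous_intros) (auto simp: f_def)
  then show ?thesis by (auto simp: homeomorphic_def)
qed

section \<open>Application to the reduced flow\<close>

lemma reduced_flow_energy_solution:
  assumes "\<alpha> \<ge> 2" "h \<noteq> 0" "x \<in> energy_surface_pos \<alpha> h \<delta>"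
  shows "energy_solution \<alpha> h \<delta> (\<lambda>t. reduced_flow \<alpha> \<delta> t x)"
  using reduced_field_generates_flow[OF assms(1,2), of \<delta>] assms(3)
  unfolding generates_flow_on_def energy_solution_def integral_curve_def flow_on_def reduced_flow_def
  by (auto simp flip: reduced_field_eq_full_field)

lemma reduced_flow_crosses_once:
  assumes \<alpha>: "\<alpha> \<ge> 2" and h: "h \<noteq> 0"
  shows "crosses_once (energy_surface_pos \<alpha> h \<delta>) (reduced_flow \<alpha> \<delta>) (\<lambda>x. fst (snd x))"
proof -
  have "flow_on (energy_surface_pos \<alpha> h \<delta>) (reduced_flow \<alpha> \<delta>)"
    using reduced_field_generates_flow[OF assms, of \<delta>]
    by (simp add: generates_flow_on_def reduced_flow_def)
  moreover have "continuous_on (energy_surface_pos \<alpha> h \<delta>) (\<lambda>x. fst (snd x))"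
    by (intro continuous_intros)
  ultimately show ?thesis
    unfolding crosses_once_def
    using energy_solution_v_decreasing[OF assms reduced_flow_energy_solution[OF assms]]
      energy_solution_v_zero[OF assms reduced_flow_energy_solution[OF assms]] by blast
qed

theorem mainTheorem3:
  fixes \<alpha> h \<epsilon> :: real
  assumes "\<alpha> \<ge> 2" and "h < 0" and "0 < \<epsilon>" and "\<epsilon> < \<bar>h\<bar> powr (- 1 / \<alpha>)"
  shows "(\<forall>\<delta>\<in>{0, \<epsilon>}.
            generates_flow_on (reduced_field \<alpha> \<delta>) phase_space (energy_surface_pos \<alpha> h \<delta>) \<and>
            (\<forall>x\<in>energy_surface_pos \<alpha> h \<delta>.
               \<not> periodic (\<lambda>\<tau>. reduced_flow \<alpha> \<delta> \<tau> x) \<and>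
               ((\<lambda>\<tau>. fst (reduced_flow \<alpha> \<delta> \<tau> x)) \<longlongrightarrow> 0) at_top \<and>
               ((\<lambda>\<tau>. fst (reduced_flow \<alpha> \<delta> \<tau> x)) \<longlongrightarrow> 0) at_bot)) \<and>
         topologically_equivalent
           (energy_surface_pos \<alpha> h 0) (reduced_flow \<alpha> 0)
           (energy_surface_pos \<alpha> h \<epsilon>) (reduced_flow \<alpha> \<epsilon>)"
proof (intro conjI ballI)
  have \<alpha>: "\<alpha> \<ge> 2" and h: "h \<noteq> 0" using assms by auto
  fix \<delta>
  show "generates_flow_on (reduced_field \<alpha> \<delta>) phase_space (energy_surface_pos \<alpha> h \<delta>)"
    by (rule reduced_field_generates_flow[OF \<alpha> h])
  fix x assume "x \<in> energy_surface_pos \<alpha> h \<delta>"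
  then have sol: "energy_solution \<alpha> h \<delta> (\<lambda>\<tau>. reduced_flow \<alpha> \<delta> \<tau> x)"
    by (rule reduced_flow_energy_solution[OF \<alpha> h])
  show "\<not> periodic (\<lambda>\<tau>. reduced_flow \<alpha> \<delta> \<tau> x)"
    using energy_solution_v_decreasing[OF \<alpha> h sol] unfolding periodic_def
    by (metis add_0 less_irrefl)
  show "((\<lambda>\<tau>. fst (reduced_flow \<alpha> \<delta> \<tau> x)) \<longlongrightarrow> 0) at_top"
    by (rule energy_solution_falls(2)[OF \<alpha> h sol])
  show "((\<lambda>\<tau>. fst (reduced_flow \<alpha> \<delta> \<tau> x)) \<longlongrightarrow> 0) at_bot"
    by (rule energy_solution_ejects(2)[OF \<alpha> h sol])
next
  have \<alpha>: "\<alpha> \<ge> 2" and h: "h \<noteq> 0" using assms by auto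
  \<comment> \<open>The assumption says that the radicand defining the endpoint of the section
    interval is positive. The interval is then nonempty and homeomorphic to the line, whatever its
    length, so the line links the sections for different \<delta>.\<close>
  have "{x \<in> energy_surface_pos \<alpha> h \<delta>. fst (snd x) = 0} homeomorphic (UNIV :: real set)"
    if "\<bar>h\<bar> * (\<delta>\<^sup>2) powr (\<alpha> / 2) < 1" for \<delta>
    using \<alpha> that by (intro homeomorphic_trans[OF section_homeomorphic_interval[OF _ h refl]]
        homeomorphic_open_interval_UNIV) auto
  moreover have "\<bar>h\<bar> * (\<epsilon>\<^sup>2) powr (\<alpha> / 2) < 1"
  proof -
    have "(\<epsilon>\<^sup>2) powr (\<alpha> / 2) = \<epsilon> powr \<alpha>"
      using assms by (simp add: powr_powr flip: powr_numeral)
    also have "\<dots> < (\<bar>h\<bar> powr (- 1 / \<alpha>)) powr \<alpha>"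
      using assms by (intro powr_less_mono2) auto
    also have "\<dots> = \<bar>h\<bar> powr - 1" unfolding powr_powr using assms by simp
    also have "\<dots> = 1 / \<bar>h\<bar>" by (simp add: powr_minus_divide)
    finally show ?thesis using h by (simp add: pos_less_divide_eq mult.commute)
  qed
  moreover have "\<bar>h\<bar> * (0\<^sup>2) powr (\<alpha> / 2) < 1" using \<alpha> by simp
  ultimately have "{x \<in> energy_surface_pos \<alpha> h 0. fst (snd x) = 0} homeomorphic
      {x \<in> energy_surface_pos \<alpha> h \<epsilon>. fst (snd x) = 0}"
    by (meson homeomorphic_sym homeomorphic_trans)
  then show "topologically_equivalent
      (energy_surface_pos \<alpha> h 0) (reduced_flow \<alpha> 0) (energy_surface_pos \<alpha> h \<epsilon>) (reduced_flow \<alpha> \<epsilon>)"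
    by (rule crosses_once_topologically_equivalent[OF
          reduced_flow_crosses_once[OF \<alpha> h] reduced_flow_crosses_once[OF \<alpha> h]])
qed

end
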